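(* (Forward part.) If $x=(x_1,x_2,x_3)$ is a rational $\mathcal{P}$-inner function and the degree of $x_3$ is $n$, then there exist polynomials $N_1,N_2,D$ and a finite Blaschke product $B$ such that (1) $(x_2,x_3)=\left(\frac{N_2}{D},\frac{D^{\sim n}}{D}\right)$ is a rational $\Gamma$-inner function; (2) $x_1=B\,\frac{N_1}{D}$ on $\overline{\mathbb{D}}$; (3) $|N_1(\lambda)|^2=|D(\lambda)|^2-\frac14|N_2(\lambda)|^2$ for all $\lambda\in\mathbb{T}$; (4) $\deg(N_1)\le n$. (Converse.) Conversely, if $N_1,N_2,D$ are polynomials satisfying (1) and (3), that is, $\left(\frac{N_2}{D},\frac{D^{\sim n}}{D}\right)$ is a rational $\Gamma$-inner function and $|N_1(\lambda)|^2=|D(\lambda)|^2-\frac14|N_2(\lambda)|^2$ for all $\lambda\in\mathbb{T}$, then $\left(\frac{N_1}{D},\frac{N_2}{D},\frac{D^{\sim n}}{D}\right)$ is a rational $\mathcal{P}$-inner function and the degree of $\frac{D^{\sim n}}{D}$ is equal to $n$. (Uniqueness.) Furthermore, let $x$, $n$, $N_1,N_2,D$ and $B$ be as in the forward part. Then a triple of polynomials $N_1',N_2',D'$ satisfies (1)–(4) (for the same $x$ and $B$, with $N_1',N_2',D'$ in place of $N_1,N_2,D$) if and only if there exists a non-zero real number $t$ such that $N_1=tN_1'$, $N_2=tN_2'$ and $D=tD'$.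
   Context: $\mathbb{D}$ is the open unit disc and $\mathbb{T}$ the unit circle in $\mathbb{C}$. The pentablock is $\mathcal{P}=\{(a_{21},\operatorname{tr}(A),\det(A)) : A=[a_{ij}]\in M_2(\mathbb{C}),\ \|A\|<1\}\subset\mathbb{C}^3$ (operator norm), with closure $\overline{\mathcal{P}}$. The symmetrized bidisc is $\mathbb{G}=\{(\operatorname{tr}(A),\det(A)) : A\in M_2(\mathbb{C}),\ \|A\|<1\}\subset\mathbb{C}^2$, with closure $\Gamma$. The distinguished boundary $b\Omega$ of a bounded polynomially convex domain $\Omega\subset\mathbb{C}^d$ is the smallest closed subset of $\overline{\Omega}$ on which every continuous function on $\overline{\Omega}$ that is holomorphic in $\Omega$ attains its maximum modulus. It is known that the distinguished boundary of $\mathbb{G}$, written $b\Gamma$, is $b\Gamma=\{(s,p)\in\mathbb{C}^2: |s|\le 2,\ s=\overline{s}p,\ |p|=1\}$, and that $b\mathcal{P}=\{(a,s,p)\in\mathbb{C}^3:(s,p)\in b\Gamma,\ |a|=\sqrt{1-\tfrac14|s|^2}\}$. A rational $\mathcal{P}$-inner function is an analytic map $x=(x_1,x_2,x_3):\mathbb{D}\to\overline{\mathcal{P}}$ such that each $x_i$ is a rational function with poles outside $\overline{\mathbb{D}}$ and $x(\lambda)\in b\mathcal{P}$ for all $\lambda\in\mathbb{T}$. A rational $\Gamma$-inner function is an analytic map $(s,p):\mathbb{D}\to\Gamma$ such that $s,p$ are rational functions with poles outside $\overline{\mathbb{D}}$ and $(s(\lambda),p(\lambda))\in b\Gamma$ for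 all $\lambda\in\mathbb{T}$. A finite Blaschke product is a function $B(z)=e^{i\theta}\prod_{j=1}^{k}\frac{z-a_j}{1-\overline{a_j}z}$ with $\theta\in[0,2\pi]$, $k\ge0$ and $a_1,\dots,a_k\in\mathbb{D}$ (the case $k=0$ being a unimodular constant). For a non-negative integer $n$ and a polynomial $f$ with $\deg(f)\le n$, $f^{\sim n}$ is the polynomial $f^{\sim n}(\lambda)=\lambda^n\,\overline{f(1/\overline{\lambda})}$; writing $D^{\sim n}$ presupposes $\deg(D)\le n$. For a rational function $r=f/g$ with $f,g$ relatively prime polynomials, $\deg(r)=\max\{\deg(f),\deg(g)\}$.
   Formalization: Condition (1) is read as including that D has no zeros in the closed unit disc; without this the converse fails, e.g. D = z−1, n = 1, N_2 = 0, N_1 = D gives D^{∼1}/D = −1, of degree 0. *)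

theory Defs
  imports
    "HOL-Complex_Analysis.Complex_Analysis"
    "HOL-Computational_Algebra.Polynomial_Factorial"
    "HOL-Computational_Algebra.Field_as_Ring"
begin

unbundle no fps_syntax

section \<open>Symmetrized bidisc and pentablock\<close>

text \<open>\<^term>\<open>onorm ((*v) A)\<close> is the operator norm for the Euclidean (Hermitian) norm on
  \<^typ>\<open>complex^2\<close>.\<close>

definition sym_bidisc :: "(complex^2) set" where
  "sym_bidisc = {vector [trace A, det A] | A :: complex^2^2. onorm ((*v) A) < 1}"

definition pentablock :: "(complex^3) set" where
  "pentablock = {vector [A $ 2 $ 1, trace A, det A] | A :: complex^2^2. onorm ((*v) A) < 1}"

section \<open>Distinguished boundary\<close>

text \<open>Holomorphy on an open subset of \<open>\<complex>\<^sup>d\<close>: the real Frechet derivative exists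
  everywhere and is complex-linear.\<close>

definition holomorphic_on_vec :: "(complex^'d \<Rightarrow> complex) \<Rightarrow> (complex^'d) set \<Rightarrow> bool" where
  "holomorphic_on_vec f \<Omega> \<longleftrightarrow>
     (\<forall>z\<in>\<Omega>. \<exists>f'. (f has_derivative f') (at z) \<and> Vector_Spaces.linear (*s) (*) f')"

definition max_modulus_set :: "(complex^'d) set \<Rightarrow> (complex^'d) set \<Rightarrow> bool" where
  "max_modulus_set \<Omega> E \<longleftrightarrow> closed E \<and> E \<subseteq> closure \<Omega> \<and>
     (\<forall>f. continuous_on (closure \<Omega>) f \<and> holomorphic_on_vec f \<Omega> \<longrightarrow>
        (\<exists>z\<in>E. \<forall>w\<in>closure \<Omega>. cmod (f w) \<le> cmod (f z)))"

text \<open>The order used by \<open>LEAST\<close> is set inclusion.\<close>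

definition distinguished_boundary :: "(complex^'d) set \<Rightarrow> (complex^'d) set" where
  "distinguished_boundary \<Omega> = (LEAST E. max_modulus_set \<Omega> E)"

section \<open>Rational functions without poles in the closed disc\<close>

text \<open>Such a function is represented by its values on the closed unit disc; its values elsewhere
  are irrelevant.\<close>

definition lowest_terms :: "(complex \<Rightarrow> complex) \<Rightarrow> complex poly \<Rightarrow> complex poly \<Rightarrow> bool" where
  "lowest_terms r f g \<longleftrightarrow> coprime f g \<and>
     (\<forall>z\<in>cball 0 1. poly g z \<noteq> 0 \<and> r z = poly f z / poly g z)"

definition rational_cdisc :: "(complex \<Rightarrow> complex) \<Rightarrow> bool" where
  "rational_cdisc r \<longleftrightarrow> (\<exists>f g. lowest_terms r f g)"

definition rat_degree :: "(complex \<Rightarrow> complex) \<Rightarrow> nat" where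
  "rat_degree r = (THE n. \<exists>f g. lowest_terms r f g \<and> n = max (degree f) (degree g))"

lemma lowest_terms_dvd:
  assumes "lowest_terms r f g" "lowest_terms r f' g'"
  shows "f dvd f'" "g dvd g'"
proof -
  have cop: "coprime f g" using assms(1) by (simp add: lowest_terms_def)
  have "poly (f * g' - f' * g) z = 0" if "z \<in> cball 0 1" for z
  proof -
    have nz: "poly g z \<noteq> 0" "poly g' z \<noteq> 0"
      and r: "r z = poly f z / poly g z" "r z = poly f' z / poly g' z"
      using assms that unfolding lowest_terms_def by blast+
    have "poly f z / poly g z = poly f' z / poly g' z"
      using r by simp
    with nz
    show ?thesis by (simp add: frac_eq_eq)
  qed
  moreover have "infinite (cball (0::complex) 1)"
    using uncountable_cball[of 1 "0::complex"] countable_finite by auto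
  ultimately have "infinite {z. poly (f * g' - f' * g) z = 0}"
    using finite_subset[of "cball 0 1" "{z. poly (f * g' - f' * g) z = 0}"] by blast
  then have eq: "f * g' = f' * g"
    using poly_roots_finite[of "f * g' - f' * g"] by auto
  show "f dvd f'"
    using coprime_dvd_mult_left_iff[OF cop, of f'] eq by (metis dvd_triv_left)
  show "g dvd g'"
    using coprime_dvd_mult_right_iff[of g f g'] cop eq by (metis coprime_commute dvd_triv_right)
qed

lemma rat_degree_eq:
  assumes "lowest_terms r f g"
  shows "rat_degree r = max (degree f) (degree g)"
proof -
  have "degree f' = degree f \<and> degree g' = degree g" if "lowest_terms r f' g'" for f' g'
    using lowest_terms_dvd[OF assms that] lowest_terms_dvd[OF that assms]
    by (metis dvd_0_left_iff dvd_imp_degree_le le_antisym)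
  then have "n = max (degree f) (degree g)"
    if "\<exists>f' g'. lowest_terms r f' g' \<and> n = max (degree f') (degree g')" for n
    using that by auto
  moreover have "\<exists>f' g'. lowest_terms r f' g' \<and> max (degree f) (degree g) = max (degree f') (degree g')"
    using assms by blast
  ultimately show ?thesis
    unfolding rat_degree_def by (intro the_equality)
qed

section \<open>Rational inner functions\<close>

definition rational_Gamma_inner :: "(complex \<Rightarrow> complex^2) \<Rightarrow> bool" where
  "rational_Gamma_inner h \<longleftrightarrow>
     (\<forall>i. (\<lambda>z. h z $ i) holomorphic_on ball 0 1) \<and>
     h ` ball 0 1 \<subseteq> closure sym_bidisc \<and>
     (\<forall>i. rational_cdisc (\<lambda>z. h z $ i)) \<and>
     (\<forall>z\<in>sphere 0 1. h z \<in> distinguished_boundary sym_bidisc)"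

definition rational_P_inner :: "(complex \<Rightarrow> complex^3) \<Rightarrow> bool" where
  "rational_P_inner x \<longleftrightarrow>
     (\<forall>i. (\<lambda>z. x z $ i) holomorphic_on ball 0 1) \<and>
     x ` ball 0 1 \<subseteq> closure pentablock \<and>
     (\<forall>i. rational_cdisc (\<lambda>z. x z $ i)) \<and>
     (\<forall>z\<in>sphere 0 1. x z \<in> distinguished_boundary pentablock)"

definition finite_Blaschke :: "(complex \<Rightarrow> complex) \<Rightarrow> bool" where
  "finite_Blaschke B \<longleftrightarrow>
     (\<exists>\<theta>\<in>{0..2*pi}. \<exists>k. \<exists>a :: nat \<Rightarrow> complex. (\<forall>j\<in>{1..k}. a j \<in> ball 0 1) \<and>
        B = (\<lambda>z. exp (\<i> * of_real \<theta>) * (\<Prod>j=1..k. (z - a j) / (1 - cnj (a j) * z))))"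

section \<open>The polynomial \<open>f\<^sup>\<sim>\<^sup>n\<close>\<close>

definition conj_reverse :: "nat \<Rightarrow> complex poly \<Rightarrow> complex poly" where
  "conj_reverse n f = (\<Sum>i\<le>n. monom (cnj (coeff f i)) (n - i))"

lemma poly_conj_reverse:
  assumes "degree f \<le> n" "z \<noteq> 0"
  shows "poly (conj_reverse n f) z = z ^ n * cnj (poly f (1 / cnj z))"
proof -
  have "poly f w = (\<Sum>i\<le>n. coeff f i * w ^ i)" for w
    unfolding poly_altdef using assms(1)
    by (intro sum.mono_neutral_left) (auto simp: coeff_eq_0)
  then have "z ^ n * cnj (poly f (1 / cnj z)) = (\<Sum>i\<le>n. cnj (coeff f i) * (z ^ n * (1 / z) ^ i))"
    by (simp add: sum_distrib_left algebra_simps)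
  also have "\<dots> = (\<Sum>i\<le>n. cnj (coeff f i) * z ^ (n - i))"
    using assms(2) by (intro sum.cong) (auto simp: power_diff power_divide)
  finally show ?thesis
    by (simp add: conj_reverse_def poly_sum poly_monom)
qed

section \<open>The conditions on \<open>N\<^sub>1\<close>, \<open>N\<^sub>2\<close>, \<open>D\<close>\<close>

text \<open>Quotients of polynomials are taken pointwise on the closed disc. They must be defined
  there, so \<open>D\<close> has no zeros in it: otherwise common zeros of numerators and denominator could
  cancel (\<open>D = z - 1\<close>, \<open>n = 1\<close> gives the constant \<open>D\<^sup>\<sim>\<^sup>n / D = -1\<close>, whose degree is not \<open>n\<close>).\<close>

definition Gamma_inner_quotient :: "nat \<Rightarrow> complex poly \<Rightarrow> complex poly \<Rightarrow> bool" where
  "Gamma_inner_quotient n N2 D \<longleftrightarrow>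
     degree D \<le> n \<and> (\<forall>z\<in>cball 0 1. poly D z \<noteq> 0) \<and>
     rational_Gamma_inner (\<lambda>z. vector [poly N2 z / poly D z, poly (conj_reverse n D) z / poly D z])"

definition modulus_identity :: "complex poly \<Rightarrow> complex poly \<Rightarrow> complex poly \<Rightarrow> bool" where
  "modulus_identity N1 N2 D \<longleftrightarrow>
     (\<forall>z\<in>sphere 0 1. (cmod (poly N1 z))\<^sup>2 = (cmod (poly D z))\<^sup>2 - 1/4 * (cmod (poly N2 z))\<^sup>2)"

definition P_inner_factorization ::
  "(complex \<Rightarrow> complex^3) \<Rightarrow> nat \<Rightarrow> (complex \<Rightarrow> complex) \<Rightarrow>
     complex poly \<Rightarrow> complex poly \<Rightarrow> complex poly \<Rightarrow> bool" where
  "P_inner_factorization x n B N1 N2 D \<longleftrightarrow>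
     Gamma_inner_quotient n N2 D \<and>
     (\<forall>z\<in>cball 0 1. x z $ 2 = poly N2 z / poly D z \<and>
                     x z $ 3 = poly (conj_reverse n D) z / poly D z) \<and>
     (\<forall>z\<in>cball 0 1. x z $ 1 = B z * (poly N1 z / poly D z)) \<and>
     modulus_identity N1 N2 D \<and>
     degree N1 \<le> n"

end

theory Submission
  imports Defs
begin

(* Formal_Laurent_Series shadows the bundle fps_syntax, so unbundling it leaves this one in place. *)
no_notation fps_nth (infixl \<open>$\<close> 75)

text \<open>
  Both domains are images of the open unit ball of \<open>2 \<times> 2\<close> matrices. Writing a strict contraction
  in singular value form and replacing the singular values by Moebius maps gives an analytic disc
  through it whose boundary consists of unitaries; together with the maximum principle in the
  \<open>a\<close>-fibres this shows that the expected sets carry the maximum modulus, and polynomial peak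
  functions show that they are the smallest such sets.

  Forward part: write \<open>x\<^sub>3 = D\<^sup>\<sim>\<^sup>n/D\<close>. On the circle \<open>s = cnj s \<cdot> p\<close> forces the denominator of \<open>x\<^sub>2\<close> to
  divide \<open>D\<close>. If \<open>x\<^sub>1 = f/g\<close> in lowest terms and \<open>f = BF\<close> with \<open>B\<close> a Blaschke product and \<open>F\<close> free of
  zeros in the disc, the identity \<open>\<bar>f\<bar>\<^sup>2\<bar>D\<bar>\<^sup>2 = \<bar>g\<bar>\<^sup>2(\<bar>D\<bar>\<^sup>2 - \<bar>N\<^sub>2\<bar>\<^sup>2/4)\<close> on the circle makes \<open>g\<close> divide
  \<open>FD\<close>, and \<open>N\<^sub>1 = FD/g\<close>; no Fejer--Riesz factorisation is needed.

  Converse: \<open>N\<^sub>1 = z\<^sup>kM\<close> with \<open>deg M \<le> n\<close>, and the matrix \<open>[[s/2, - M\<^sup>\<sim>\<^sup>n/D], [M/D, s/2]]\<close> is unitary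
  on the circle, hence contractive in the disc, with determinant \<open>p\<close>.
\<close>

section \<open>Reversed polynomials and Blaschke factors\<close>

text \<open>On the circle \<open>cnj (f z)\<close> is the reversal of \<open>f\<close> divided by
  \<open>z ^ n\<close>, so an identity between moduli becomes an identity of polynomials, and such
  identities are exploited through divisibility. The coprimality this requires comes from the
  location of zeros: denominators vanish only outside the closed disc, while the reversal of a
  polynomial without zeros in the open disc vanishes only in the closed disc. This is why a Blaschke
  product is split off the numerator of the first coordinate: were that numerator to keep zeros in
  the disc, its reversal could share factors with the denominator.

  For the distinguished boundary of the pentablock the obstacle is that unitary matrices need not
  land in it. A unitary matrix with diagonal \<open>a\<close>, \<open>d\<close> has a corner of
  squared modulus \<open>1 - |a|^2\<close>, whereas the boundary demands
  \<open>1 - |a + d|^2 / 4\<close>, which is larger unless \<open>a = d\<close>. The matrix discs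
  therefore reach only the fibres over the boundary of the symmetrized bidisc, and a second maximum
  principle has to act inside these fibres.\<close>

lemma poly_eqI_circle:
  fixes p q :: "complex poly"
  assumes "\<And>z. cmod z = 1 \<Longrightarrow> poly p z = poly q z"
  shows "p = q"
proof -
  have "uncountable (sphere (0::complex) 1)"
    by (rule connected_uncountable[of _ 1 "-1"]) (auto intro: connected_sphere)
  then have "infinite (sphere (0::complex) 1)"
    using countable_finite by blast
  moreover have "sphere 0 1 \<subseteq> {z. poly (p - q) z = 0}"
    using assms by auto
  ultimately have "infinite {z. poly (p - q) z = 0}"
    using finite_subset by blast
  then show ?thesis
    using poly_roots_finite[of "p - q"] by auto
qed

lemma complex_poly_root:
  fixes p :: "complex poly"
  assumes "degree p > 0"
  obtains z where "poly p z = 0"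
proof -
  have "coeff p 0 = 0 \<or> (\<exists>i\<in>{1..degree p}. coeff p i \<noteq> 0)"
    using assms by (intro disjI2 bexI[of _ "degree p"]) auto
  from fundamental_theorem_of_algebra[OF this] show thesis
    using that by (metis poly_altdef)
qed

lemma coprime_polyI_no_common_root:
  fixes p q :: "complex poly"
  assumes "p \<noteq> 0" "\<And>z. poly p z = 0 \<Longrightarrow> poly q z \<noteq> 0"
  shows "coprime p q"
proof (rule coprimeI)
  fix c assume c: "c dvd p" "c dvd q"
  show "is_unit c"
  proof (rule ccontr)
    assume "\<not> is_unit c"
    moreover have "c \<noteq> 0" using c assms(1) by auto
    ultimately obtain z where "poly c z = 0"
      using complex_poly_root[of c] by (auto simp: is_unit_iff_degree)
    then have "poly p z = 0" "poly q z = 0"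
      using c by (auto elim!: dvdE)
    then show False using assms(2) by blast
  qed
qed

lemma coeff_conj_reverse:
  "coeff (conj_reverse n f) k = (if k \<le> n then cnj (coeff f (n - k)) else 0)"
proof -
  have "coeff (conj_reverse n f) k = (\<Sum>i\<le>n. if i = n - k \<and> k \<le> n then cnj (coeff f i) else 0)"
    unfolding conj_reverse_def coeff_sum coeff_monom by (intro sum.cong) auto
  then show ?thesis by (cases "k \<le> n") simp_all
qed

lemma degree_conj_reverse_le: "degree (conj_reverse n f) \<le> n"
  by (rule degree_le) (auto simp: coeff_conj_reverse)

lemma degree_conj_reverse:
  assumes "poly f 0 \<noteq> 0"
  shows "degree (conj_reverse n f) = n"
proof (rule antisym[OF degree_conj_reverse_le])
  show "n \<le> degree (conj_reverse n f)"
    using assms by (intro le_degree) (simp add: coeff_conj_reverse poly_0_coeff_0)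
qed

lemma conj_reverse_smult: "conj_reverse n (smult c f) = smult (cnj c) (conj_reverse n f)"
  by (rule poly_eqI) (simp add: coeff_conj_reverse)

lemma poly_conj_reverse_circle:
  assumes "degree f \<le> n" "cmod z = 1"
  shows "poly (conj_reverse n f) z = z ^ n * cnj (poly f z)"
proof -
  have "z \<noteq> 0" "1 / cnj z = z"
    using assms(2) complex_norm_square[of z] by (auto simp: divide_simps)
  then show ?thesis using poly_conj_reverse[OF assms(1)] by simp
qed

lemma conj_reverse_eq_0_iff:
  assumes "degree f \<le> n"
  shows "conj_reverse n f = 0 \<longleftrightarrow> f = 0"
proof
  assume *: "conj_reverse n f = 0"
  show "f = 0"
  proof (rule poly_eqI)
    fix k
    have "coeff (conj_reverse n f) (n - k) = 0" using * by simp
    then show "coeff f k = coeff 0 k"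
      using assms by (cases "k \<le> n") (auto simp: coeff_conj_reverse coeff_eq_0)
  qed
qed (simp add: conj_reverse_def)

lemma conj_reverse_root:
  assumes "degree f \<le> n" "poly (conj_reverse n f) z = 0" "z \<noteq> 0"
  shows "poly f (1 / cnj z) = 0"
  using assms poly_conj_reverse[of f n z] by simp

lemma mult_conj_reverse_circle:
  assumes "degree f \<le> n" "cmod z = 1"
  shows "poly (f * conj_reverse n f) z = z ^ n * of_real ((cmod (poly f z))\<^sup>2)"
  by (simp add: poly_conj_reverse_circle[OF assms] complex_norm_square del: of_real_power)

text \<open>Reversal reflects non-zero roots in the circle by \<open>z \<mapsto> 1 / cnj z\<close>,
  so a root of \<open>g\<close>, having modulus above one, would give \<open>f\<close> a root in the
  open disc. Roots of \<open>f\<close> on the circle are harmless, and outer factors may have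
  them.\<close>

lemma coprime_conj_reverse:
  assumes "\<And>z. cmod z \<le> 1 \<Longrightarrow> poly g z \<noteq> 0" "\<And>z. cmod z < 1 \<Longrightarrow> poly f z \<noteq> 0" "degree f \<le> n"
  shows "coprime g (conj_reverse n f)"
proof (rule coprime_polyI_no_common_root)
  show "g \<noteq> 0" using assms(1)[of 0] by auto
  fix z assume z: "poly g z = 0"
  then have "cmod z > 1" using assms(1) by force
  then have "cmod (1 / cnj z) < 1" "z \<noteq> 0" by (auto simp: norm_divide divide_less_eq)
  then show "poly (conj_reverse n f) z \<noteq> 0"
    using conj_reverse_root[OF assms(3)] assms(2) by blast
qed

lemma rational_cdisc_quotient:
  assumes "\<And>z. cmod z \<le> 1 \<Longrightarrow> poly g z \<noteq> 0"
  shows "rational_cdisc (\<lambda>z. poly f z / poly g z)"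
proof -
  have g: "g \<noteq> 0" using assms[of 0] by auto
  define h where "h = gcd f g"
  obtain f' g' where fg: "f = h * f'" "g = h * g'"
    unfolding h_def by (meson dvdE gcd_dvd1 gcd_dvd2)
  have h: "h \<noteq> 0" using g fg by auto
  have "f' = f div h" "g' = g div h" using fg h by simp_all
  then have "coprime f' g'" using g unfolding h_def by (metis div_gcd_coprime)
  moreover have "poly g' z \<noteq> 0 \<and> poly f z / poly g z = poly f' z / poly g' z" if "cmod z \<le> 1" for z
    using assms[OF that] unfolding fg by auto
  ultimately show ?thesis unfolding rational_cdisc_def lowest_terms_def
    by (intro exI[of _ f'] exI[of _ g']) auto
qed

section \<open>Finite Blaschke products and the splitting off of zeros in the disc\<close>

lemma finite_Blaschke_one: "finite_Blaschke (\<lambda>z. 1)"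
  unfolding finite_Blaschke_def by (rule bexI[of _ 0], rule exI[of _ 0]) auto

lemma finite_Blaschke_mult_factor:
  assumes "finite_Blaschke B" "cmod a < 1"
  shows "finite_Blaschke (\<lambda>z. (z - a) / (1 - cnj a * z) * B z)"
proof -
  obtain \<theta> k b where \<theta>: "\<theta> \<in> {0..2*pi}" and b: "\<forall>j\<in>{1..k::nat}. b j \<in> ball 0 1"
    and B: "B = (\<lambda>z. exp (\<i> * of_real \<theta>) * (\<Prod>j=1..k. (z - b j) / (1 - cnj (b j) * z)))"
    using assms(1) unfolding finite_Blaschke_def by blast
  define b' where "b' = b(Suc k := a)"
  have "\<forall>j\<in>{1..Suc k}. b' j \<in> ball 0 1"
    using b assms(2) by (auto simp: b'_def)
  moreover have "(\<Prod>j=1..k. (z - b' j) / (1 - cnj (b' j) * z)) = (\<Prod>j=1..k. (z - b j) / (1 - cnj (b j) * z))" for z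
    by (intro prod.cong) (auto simp: b'_def)
  then have "(\<lambda>z. (z - a) / (1 - cnj a * z) * B z)
      = (\<lambda>z. exp (\<i> * of_real \<theta>) * (\<Prod>j=1..Suc k. (z - b' j) / (1 - cnj (b' j) * z)))"
    unfolding B by (simp add: b'_def mult_ac)
  ultimately show ?thesis unfolding finite_Blaschke_def using \<theta> by blast
qed

lemma cmod_Moebius_denominator:
  assumes "cmod a < 1" "cmod z \<le> 1"
  shows "1 - cnj a * z \<noteq> 0"
proof
  assume "1 - cnj a * z = 0"
  then have "cmod (cnj a * z) = 1" by simp
  moreover have "cmod a * cmod z \<le> cmod a * 1" using assms by (intro mult_left_mono) auto
  ultimately show False using assms by (simp add: norm_mult)
qed

lemma cmod_Moebius_circle:
  assumes "cmod z = 1"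
  shows "cmod (1 - cnj a * z) = cmod (z - a)"
proof -
  have "z * cnj z = 1" using assms by (simp add: complex_norm_square[symmetric])
  then have "1 - cnj a * z = z * cnj (z - a)" by (simp add: algebra_simps)
  then show ?thesis using assms by (metis complex_mod_cnj mult_1 norm_mult)
qed

text \<open>Each zero \<open>a\<close> in the open disc is reflected outwards: \<open>z - a\<close>
  is replaced by \<open>1 - cnj a * z\<close>, which has the same modulus on the circle and no zero
  in the closed disc, and the quotient of the two joins \<open>B\<close>. Zeros on the circle stay
  in \<open>F\<close>.\<close>

lemma Blaschke_outer_factorization:
  fixes f :: "complex poly"
  assumes "f \<noteq> 0"
  obtains B F where "finite_Blaschke B" "\<And>z. cmod z < 1 \<Longrightarrow> poly F z \<noteq> 0"
    "\<And>z. cmod z \<le> 1 \<Longrightarrow> poly f z = B z * poly F z"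
    "\<And>z. cmod z = 1 \<Longrightarrow> cmod (poly f z) = cmod (poly F z)"
proof -
  have "\<exists>B F. finite_Blaschke B \<and> (\<forall>z. cmod z < 1 \<longrightarrow> poly F z \<noteq> 0) \<and>
    (\<forall>z. cmod z \<le> 1 \<longrightarrow> poly f z = B z * poly F z) \<and>
    (\<forall>z. cmod z = 1 \<longrightarrow> cmod (poly f z) = cmod (poly F z))"
    using assms
  proof (induction "degree f" arbitrary: f rule: less_induct)
    case less
    show ?case
    proof (cases "\<exists>a. cmod a < 1 \<and> poly f a = 0")
      case False
      then show ?thesis
        by (intro exI[of _ "\<lambda>z. 1"] exI[of _ f]) (auto simp: finite_Blaschke_one)
    next
      case True
      then obtain a where a: "cmod a < 1" "poly f a = 0" by blast
      then obtain g where g: "f = [:- a, 1:] * g"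
        by (auto simp: poly_eq_0_iff_dvd elim!: dvdE)
      have "g \<noteq> 0" using g less.prems by auto
      then have "degree f = Suc (degree g)"
        unfolding g by (subst degree_mult_eq) auto
      then obtain B F where BF: "finite_Blaschke B" "\<forall>z. cmod z < 1 \<longrightarrow> poly F z \<noteq> 0"
        "\<forall>z. cmod z \<le> 1 \<longrightarrow> poly g z = B z * poly F z"
        "\<forall>z. cmod z = 1 \<longrightarrow> cmod (poly g z) = cmod (poly F z)"
        using less.hyps[of g] \<open>g \<noteq> 0\<close> by auto
      let ?F = "[:1, - cnj a:] * F"
      have F: "poly ?F z = (1 - cnj a * z) * poly F z" for z by (simp add: algebra_simps)
      have f: "poly f z = (z - a) * poly g z" for z unfolding g by (simp add: algebra_simps)
      show ?thesis
      proof (intro exI conjI allI impI)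
        show "finite_Blaschke (\<lambda>z. (z - a) / (1 - cnj a * z) * B z)"
          using BF(1) a(1) by (rule finite_Blaschke_mult_factor)
        show "poly ?F z \<noteq> 0" if "cmod z < 1" for z
          using BF(2) cmod_Moebius_denominator[OF a(1), of z] that unfolding F by simp
        show "poly f z = (z - a) / (1 - cnj a * z) * B z * poly ?F z" if "cmod z \<le> 1" for z
          using BF(3) cmod_Moebius_denominator[OF a(1) that] that unfolding F f by simp
        show "cmod (poly f z) = cmod (poly ?F z)" if "cmod z = 1" for z
          using BF(4) cmod_Moebius_circle[OF that] that unfolding F f by (simp add: norm_mult)
      qed
    qed
  qed
  then show thesis using that by blast
qed

section \<open>Contractive matrices and the two domains\<close>

text \<open>Operator norm at most \<open>\<bar>r\<bar>\<close> for the matrix with rows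
  \<open>(a, b)\<close> and \<open>(c, d)\<close>. The entries are separate arguments so that an
  analytic disc of matrices is just four scalar functions.\<close>

definition bounded_matrix :: "real \<Rightarrow> complex \<Rightarrow> complex \<Rightarrow> complex \<Rightarrow> complex \<Rightarrow> bool" where
  "bounded_matrix r a b c d \<longleftrightarrow>
     (\<forall>x y. (cmod (a * x + b * y))\<^sup>2 + (cmod (c * x + d * y))\<^sup>2 \<le> r\<^sup>2 * ((cmod x)\<^sup>2 + (cmod y)\<^sup>2))"

lemma norm_complex_vec2: "(norm (v::complex^2))\<^sup>2 = (cmod (v$1))\<^sup>2 + (cmod (v$2))\<^sup>2"
  by (simp add: norm_vec_def L2_set_def sum_2)

lemma onorm_le_iff_bounded_matrix:
  fixes A :: "complex^2^2"
  assumes "r \<ge> 0"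
  shows "onorm ((*v) A) \<le> r \<longleftrightarrow> bounded_matrix r (A$1$1) (A$1$2) (A$2$1) (A$2$2)"
proof -
  have *: "(norm (A *v v) \<le> r * norm v) \<longleftrightarrow>
      (cmod (A$1$1 * v$1 + A$1$2 * v$2))\<^sup>2 + (cmod (A$2$1 * v$1 + A$2$2 * v$2))\<^sup>2
        \<le> r\<^sup>2 * ((cmod (v$1))\<^sup>2 + (cmod (v$2))\<^sup>2)" for v
  proof -
    have "norm (A *v v) \<le> r * norm v \<longleftrightarrow> (norm (A *v v))\<^sup>2 \<le> (r * norm v)\<^sup>2"
      using assms by (simp add: abs_le_square_iff[symmetric])
    then show ?thesis
      unfolding power_mult_distrib norm_complex_vec2 by (simp add: matrix_vector_mult_def sum_2)
  qed
  have "onorm ((*v) A) \<le> r \<longleftrightarrow> (\<forall>v. norm (A *v v) \<le> r * norm v)"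
  proof safe
    fix v assume "onorm ((*v) A) \<le> r"
    then show "norm (A *v v) \<le> r * norm v"
      using onorm[OF matrix_vector_mul_bounded_linear, of A v] mult_right_mono[of "onorm ((*v) A)" r "norm v"]
      by auto
  next
    assume "\<forall>v. norm (A *v v) \<le> r * norm v"
    then show "onorm ((*v) A) \<le> r" using assms by (intro onorm_bound) auto
  qed
  also have "\<dots> \<longleftrightarrow> bounded_matrix r (A$1$1) (A$1$2) (A$2$1) (A$2$2)"
    unfolding bounded_matrix_def *
  proof safe
    fix x y
    assume "\<forall>v::complex^2. (cmod (A$1$1 * v$1 + A$1$2 * v$2))\<^sup>2 + (cmod (A$2$1 * v$1 + A$2$2 * v$2))\<^sup>2
        \<le> r\<^sup>2 * ((cmod (v$1))\<^sup>2 + (cmod (v$2))\<^sup>2)"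
    from spec[OF this, of "vector [x, y]"]
    show "(cmod (A$1$1 * x + A$1$2 * y))\<^sup>2 + (cmod (A$2$1 * x + A$2$2 * y))\<^sup>2
        \<le> r\<^sup>2 * ((cmod x)\<^sup>2 + (cmod y)\<^sup>2)" by simp
  qed auto
  finally show ?thesis .
qed

lemma bounded_matrix_mono:
  assumes "bounded_matrix r a b c d" "0 \<le> r" "r \<le> s"
  shows "bounded_matrix s a b c d"
  unfolding bounded_matrix_def
proof (intro allI)
  fix x y
  have "r\<^sup>2 * ((cmod x)\<^sup>2 + (cmod y)\<^sup>2) \<le> s\<^sup>2 * ((cmod x)\<^sup>2 + (cmod y)\<^sup>2)"
    using assms by (intro mult_right_mono power_mono) auto
  then show "(cmod (a * x + b * y))\<^sup>2 + (cmod (c * x + d * y))\<^sup>2 \<le> s\<^sup>2 * ((cmod x)\<^sup>2 + (cmod y)\<^sup>2)"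
    using assms(1) unfolding bounded_matrix_def by (meson order_trans)
qed

lemma bounded_matrix_scale:
  assumes "bounded_matrix 1 a b c d"
  shows "bounded_matrix r (of_real r * a) (of_real r * b) (of_real r * c) (of_real r * d)"
  unfolding bounded_matrix_def
proof (intro allI)
  fix x y
  have "(cmod (of_real r * a * x + of_real r * b * y))\<^sup>2 + (cmod (of_real r * c * x + of_real r * d * y))\<^sup>2
      = r\<^sup>2 * ((cmod (a * x + b * y))\<^sup>2 + (cmod (c * x + d * y))\<^sup>2)"
    by (simp add: mult.assoc distrib_left[symmetric] norm_mult power_mult_distrib)
  also have "\<dots> \<le> r\<^sup>2 * ((cmod x)\<^sup>2 + (cmod y)\<^sup>2)"
    using assms unfolding bounded_matrix_def by (intro mult_left_mono) auto
  finally show "(cmod (of_real r * a * x + of_real r * b * y))\<^sup>2 + (cmod (of_real r * c * x + of_real r * d * y))\<^sup>2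
      \<le> r\<^sup>2 * ((cmod x)\<^sup>2 + (cmod y)\<^sup>2)" .
qed

text \<open>The entrywise predicate expresses only non-strict bounds, so strictness is carried by a
  radius \<open>r < 1\<close>, for which the operator norm itself can be taken. The parameter
  \<open>P\<close> lets the same statement serve both domains.\<close>

lemma ex_onorm_less_iff:
  "(\<exists>A::complex^2^2. onorm ((*v) A) < 1 \<and> P (A$1$1) (A$1$2) (A$2$1) (A$2$2)) \<longleftrightarrow>
   (\<exists>a b c d. \<exists>r\<in>{0..<1}. bounded_matrix r a b c d \<and> P a b c d)" (is "?L \<longleftrightarrow> ?R")
proof
  assume ?L
  then obtain A :: "complex^2^2" where A: "onorm ((*v) A) < 1" "P (A$1$1) (A$1$2) (A$2$1) (A$2$2)" by blast
  have "0 \<le> onorm ((*v) A)" by (simp add: onorm_pos_le)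
  then show ?R
    using A onorm_le_iff_bounded_matrix[of "onorm ((*v) A)" A] by (metis atLeastLessThan_iff order_refl)
next
  assume ?R
  then obtain a b c d r where *: "0 \<le> r" "r < 1" "bounded_matrix r a b c d" "P a b c d" by auto
  let ?A = "vector [vector [a, b], vector [c, d]] :: complex^2^2"
  have "onorm ((*v) ?A) \<le> r" using * onorm_le_iff_bounded_matrix[of r ?A] by simp
  then show ?L using * by (intro exI[of _ ?A]) simp
qed

lemma ex_onorm_le_iff:
  "(\<exists>A::complex^2^2. onorm ((*v) A) \<le> 1 \<and> P (A$1$1) (A$1$2) (A$2$1) (A$2$2)) \<longleftrightarrow>
   (\<exists>a b c d. bounded_matrix 1 a b c d \<and> P a b c d)" (is "?L \<longleftrightarrow> ?R")
proof
  assume ?R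
  then obtain a b c d where *: "bounded_matrix 1 a b c d" "P a b c d" by auto
  let ?A = "vector [vector [a, b], vector [c, d]] :: complex^2^2"
  have "onorm ((*v) ?A) \<le> 1" using * onorm_le_iff_bounded_matrix[of 1 ?A] by simp
  then show ?L using * by (intro exI[of _ ?A]) simp
qed (use onorm_le_iff_bounded_matrix[of 1] in auto)

lemma compact_onorm_ball: "compact {A::complex^2^2. onorm ((*v) A) \<le> 1}"
proof -
  have eq: "{A::complex^2^2. onorm ((*v) A) \<le> 1} =
    {A. \<forall>x y. (cmod (A$1$1 * x + A$1$2 * y))\<^sup>2 + (cmod (A$2$1 * x + A$2$2 * y))\<^sup>2 \<le> (cmod x)\<^sup>2 + (cmod y)\<^sup>2}"
    by (simp add: onorm_le_iff_bounded_matrix bounded_matrix_def)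
  have "closed {A::complex^2^2. onorm ((*v) A) \<le> 1}"
    unfolding eq by (intro closed_Collect_all closed_Collect_le continuous_intros)
  moreover have "norm A \<le> 2" if A: "onorm ((*v) A) \<le> 1" for A :: "complex^2^2"
  proof -
    have *: "(cmod (A$1$1 * x + A$1$2 * y))\<^sup>2 + (cmod (A$2$1 * x + A$2$2 * y))\<^sup>2 \<le> (cmod x)\<^sup>2 + (cmod y)\<^sup>2" for x y
      using A eq by blast
    have "(norm A)\<^sup>2 = (norm (A$1))\<^sup>2 + (norm (A$2))\<^sup>2"
      by (simp add: norm_vec_def[of A] L2_set_def sum_2)
    \<comment> \<open>Testing on the two basis vectors bounds each column by one, so the squared
      entries sum to at most 2.\<close>
    also have "\<dots> \<le> 2\<^sup>2"
      using *[of 1 0] *[of 0 1] unfolding norm_complex_vec2 by simp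
    finally show ?thesis by (rule power2_le_imp_le) simp
  qed
  then have "bounded {A::complex^2^2. onorm ((*v) A) \<le> 1}" by (auto intro: boundedI)
  ultimately show ?thesis by (simp add: compact_eq_bounded_closed)
qed

text \<open>The closed ball is compact, so its image is closed; conversely each \<open>A\<close> in
  it is the limit of the multiples \<open>r n *\<^sub>R A\<close>, which lie in the open ball.
  Points of either closed domain thus come from genuine contractions.\<close>

lemma closure_image_onorm_ball:
  fixes f :: "complex^2^2 \<Rightarrow> 'a::t2_space"
  assumes "continuous_on UNIV f"
  shows "closure (f ` {A. onorm ((*v) A) < 1}) = f ` {A. onorm ((*v) A) \<le> 1}"
proof (rule closure_unique)
  show "f ` {A. onorm ((*v) A) < 1} \<subseteq> f ` {A. onorm ((*v) A) \<le> 1}" by (intro image_mono) auto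
  show "closed (f ` {A. onorm ((*v) A) \<le> 1})"
    using compact_onorm_ball assms
    by (intro compact_imp_closed compact_continuous_image) (auto intro: continuous_on_subset)
next
  fix T assume T: "f ` {A. onorm ((*v) A) < 1} \<subseteq> T" "closed T"
  have "f A \<in> T" if A: "onorm ((*v) A) \<le> 1" for A
  proof -
    define r where "r n = 1 - inverse (real (Suc n))" for n
    have r: "0 \<le> r n" "r n < 1" for n by (auto simp: r_def field_simps)
    have "r \<longlonglongrightarrow> 1 - 0" unfolding r_def by (intro tendsto_intros LIMSEQ_inverse_real_of_nat)
    then have "(\<lambda>n. r n *\<^sub>R A) \<longlonglongrightarrow> 1 *\<^sub>R A" by (intro tendsto_intros) simp
    moreover have "isCont f (1 *\<^sub>R A)" using assms by (simp add: continuous_on_eq_continuous_at)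
    ultimately have "(\<lambda>n. f (r n *\<^sub>R A)) \<longlonglongrightarrow> f (1 *\<^sub>R A)" using isCont_tendsto_compose by blast
    moreover have "f (r n *\<^sub>R A) \<in> T" for n
    proof -
      have "bounded_matrix (r n) (of_real (r n) * A$1$1) (of_real (r n) * A$1$2)
          (of_real (r n) * A$2$1) (of_real (r n) * A$2$2)"
        using A by (intro bounded_matrix_scale) (simp add: onorm_le_iff_bounded_matrix)
      then have "onorm ((*v) (r n *\<^sub>R A)) \<le> r n"
        using r by (simp add: onorm_le_iff_bounded_matrix) (simp add: scaleR_conv_of_real)
      then show ?thesis using r[of n] T(1) by (intro subsetD[OF T(1)] imageI) simp
    qed
    ultimately have "f (1 *\<^sub>R A) \<in> T" 
      by (rule closed_sequentially[OF T(2), rotated])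
    then show ?thesis by simp
  qed
  then show "f ` {A. onorm ((*v) A) \<le> 1} \<subseteq> T" by blast
qed

lemma continuous_on_vector2 [continuous_intros]:
  fixes f g :: "_ \<Rightarrow> complex"
  assumes "continuous_on S f" "continuous_on S g"
  shows "continuous_on S (\<lambda>x. vector [f x, g x] :: complex^2)"
proof -
  have "(\<lambda>x. vector [f x, g x] :: complex^2) = (\<lambda>x. \<chi> i. if i = 1 then f x else g x)"
    by (rule ext) (simp add: vec_eq_iff forall_2)
  moreover have "continuous_on S (\<lambda>x. if i = 1 then f x else g x)" for i :: 2
    using assms by (cases "i = 1") simp_all
  ultimately show ?thesis by (simp only: continuous_on_vec_lambda)
qed

lemma continuous_on_vector3 [continuous_intros]:
  fixes f g h :: "_ \<Rightarrow> complex"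
  assumes "continuous_on S f" "continuous_on S g" "continuous_on S h"
  shows "continuous_on S (\<lambda>x. vector [f x, g x, h x] :: complex^3)"
proof -
  have "(\<lambda>x. vector [f x, g x, h x] :: complex^3) = (\<lambda>x. \<chi> i. if i = 1 then f x else if i = 2 then g x else h x)"
    by (rule ext) (simp add: vec_eq_iff forall_3)
  moreover have "continuous_on S (\<lambda>x. if i = 1 then f x else if i = 2 then g x else h x)" for i :: 3
    using assms by (cases "i = 1"; cases "i = 2") simp_all
  ultimately show ?thesis by (simp only: continuous_on_vec_lambda)
qed

lemma trace_2: "trace (A::complex^2^2) = A$1$1 + A$2$2"
  by (simp add: trace_def sum_2)

lemma sym_bidisc_iff:
  "w \<in> sym_bidisc \<longleftrightarrow>
     (\<exists>a b c d. \<exists>r\<in>{0..<1}. bounded_matrix r a b c d \<and> w = vector [a + d, a * d - b * c])"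
  unfolding ex_onorm_less_iff[symmetric] sym_bidisc_def trace_2 det_2 by blast

lemma pentablock_iff:
  "w \<in> pentablock \<longleftrightarrow>
     (\<exists>a b c d. \<exists>r\<in>{0..<1}. bounded_matrix r a b c d \<and> w = vector [c, a + d, a * d - b * c])"
  unfolding ex_onorm_less_iff[symmetric] pentablock_def trace_2 det_2 by blast

lemma closure_sym_bidisc:
  "closure sym_bidisc = (\<lambda>A::complex^2^2. vector [trace A, det A]) ` {A. onorm ((*v) A) \<le> 1}"
  unfolding sym_bidisc_def setcompr_eq_image trace_2 det_2
  by (intro closure_image_onorm_ball continuous_intros)

lemma closure_pentablock:
  "closure pentablock = (\<lambda>A::complex^2^2. vector [A$2$1, trace A, det A]) ` {A. onorm ((*v) A) \<le> 1}"
  unfolding pentablock_def setcompr_eq_image trace_2 det_2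
  by (intro closure_image_onorm_ball continuous_intros)

lemma closure_sym_bidisc_iff:
  "w \<in> closure sym_bidisc \<longleftrightarrow>
     (\<exists>a b c d. bounded_matrix 1 a b c d \<and> w = vector [a + d, a * d - b * c])"
  unfolding ex_onorm_le_iff[symmetric] closure_sym_bidisc trace_2 det_2 by blast

lemma closure_pentablock_iff:
  "w \<in> closure pentablock \<longleftrightarrow>
     (\<exists>a b c d. bounded_matrix 1 a b c d \<and> w = vector [c, a + d, a * d - b * c])"
  unfolding ex_onorm_le_iff[symmetric] closure_pentablock trace_2 det_2 by blast

lemma compact_closure_sym_bidisc: "compact (closure sym_bidisc)"
  unfolding closure_sym_bidisc trace_2 det_2
  by (intro compact_continuous_image compact_onorm_ball continuous_intros)

lemma compact_closure_pentablock: "compact (closure pentablock)"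
  unfolding closure_pentablock trace_2 det_2
  by (intro compact_continuous_image compact_onorm_ball continuous_intros)

text \<open>A column of norm one and a determinant of modulus one force the second column to be the
  orthogonal one.\<close>

lemma contraction_det_unimodular:
  assumes "bounded_matrix 1 a b c d"
  shows "(cmod a)\<^sup>2 + (cmod c)\<^sup>2 \<le> 1" "(cmod b)\<^sup>2 + (cmod d)\<^sup>2 \<le> 1" "cmod (a * d - b * c) \<le> 1"
    "cmod (a * d - b * c) = 1 \<Longrightarrow> d = (a * d - b * c) * cnj a"
proof -
  let ?p = "(cmod a)\<^sup>2 + (cmod c)\<^sup>2" and ?q = "(cmod b)\<^sup>2 + (cmod d)\<^sup>2"
  show p: "?p \<le> 1" and q: "?q \<le> 1"
    using assms[unfolded bounded_matrix_def, rule_format, of 1 0]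
      assms[unfolded bounded_matrix_def, rule_format, of 0 1] by simp_all
  \<comment> \<open>Lagrange's identity: the product of the squared column norms is the squared
    modulus of the determinant plus that of the inner product of the columns. Over
    \<open>complex\<close>, with \<open>z * cnj z\<close> for squared moduli, it is a ring
    identity.\<close>
  have "complex_of_real (?p * ?q) = of_real ((cmod (a * d - b * c))\<^sup>2 + (cmod (cnj a * b + cnj c * d))\<^sup>2)"
    unfolding of_real_mult of_real_add complex_norm_square by (simp add: algebra_simps)
  then have id: "?p * ?q = (cmod (a * d - b * c))\<^sup>2 + (cmod (cnj a * b + cnj c * d))\<^sup>2"
    by (simp only: of_real_eq_iff)
  have pq: "?p * ?q \<le> 1 * 1" using p q by (intro mult_mono) auto
  then have "(cmod (a * d - b * c))\<^sup>2 \<le> 1\<^sup>2" using id by (smt (verit) zero_le_power2 mult_1 one_power2)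
  then show "cmod (a * d - b * c) \<le> 1" by (rule power2_le_imp_le) simp
  assume 1: "cmod (a * d - b * c) = 1"
  then have "(cmod (cnj a * b + cnj c * d))\<^sup>2 \<le> 0" using id pq by simp
  then have orth: "cnj a * b + cnj c * d = 0" by simp
  then have pq1: "?p * ?q = 1" using id 1 by simp
  have "?p * ?q \<le> ?p * 1" using q by (intro mult_left_mono) auto
  then have "?p = 1" using pq1 p by simp
  then have "a * cnj a + c * cnj c = 1"
    unfolding complex_norm_square[symmetric] of_real_add[symmetric] by simp
  then have "d = d * (a * cnj a + c * cnj c) - c * (cnj a * b + cnj c * d)" using orth by simp
  also have "\<dots> = (a * d - b * c) * cnj a" by (simp add: algebra_simps)
  finally show "d = (a * d - b * c) * cnj a" .
qed

lemma unitary_bounded_matrix: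
  assumes "(cmod a)\<^sup>2 + (cmod c)\<^sup>2 = 1" "cmod p = 1"
  shows "bounded_matrix 1 a (- p * cnj c) c (p * cnj a)"
    and "a * (p * cnj a) - (- p * cnj c) * c = p"
proof -
  have ac: "a * cnj a + c * cnj c = 1" and pp: "p * cnj p = 1"
    unfolding complex_norm_square[symmetric] of_real_add[symmetric] using assms by simp_all
  have "(cmod (a * x + - p * cnj c * y))\<^sup>2 + (cmod (c * x + p * cnj a * y))\<^sup>2 = (cmod x)\<^sup>2 + (cmod y)\<^sup>2" for x y
  proof -
    have "(a * x + - p * cnj c * y) * cnj (a * x + - p * cnj c * y) + (c * x + p * cnj a * y) * cnj (c * x + p * cnj a * y)
      = (a * cnj a + c * cnj c) * (x * cnj x) + (p * cnj p) * (a * cnj a + c * cnj c) * (y * cnj y)"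
      by (simp add: algebra_simps)
    then show ?thesis
      unfolding ac pp unfolding complex_norm_square[symmetric] of_real_add[symmetric] mult_1 of_real_eq_iff .
  qed
  then show "bounded_matrix 1 a (- p * cnj c) c (p * cnj a)" by (simp add: bounded_matrix_def)
  have "a * (p * cnj a) - (- p * cnj c) * c = p * (a * cnj a + c * cnj c)" by (simp add: algebra_simps)
  then show "a * (p * cnj a) - (- p * cnj c) * c = p" using ac by simp
qed

section \<open>The expected boundaries and the unitary matrices above them\<close>

definition Gamma_boundary :: "(complex^2) set" where
  "Gamma_boundary = {w. cmod (w$1) \<le> 2 \<and> w$1 = cnj (w$1) * w$2 \<and> cmod (w$2) = 1}"

text \<open>The condition on the first coordinate is the usual one squared; since
  \<open>cmod (w$2) \<le> 2\<close>, the radicand is non-negative and nothing changes.\<close>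

definition penta_boundary :: "(complex^3) set" where
  "penta_boundary = {w. cmod (w$2) \<le> 2 \<and> w$2 = cnj (w$2) * w$3 \<and> cmod (w$3) = 1 \<and>
     (cmod (w$1))\<^sup>2 = 1 - (cmod (w$2))\<^sup>2 / 4}"

lemma Gamma_boundaryD:
  assumes "w \<in> Gamma_boundary"
  shows "cmod (w$1) \<le> 2" "w$1 = cnj (w$1) * w$2" "cmod (w$2) = 1"
  using assms by (simp_all only: Gamma_boundary_def mem_Collect_eq)

lemma penta_boundaryD:
  assumes "w \<in> penta_boundary"
  shows "cmod (w$2) \<le> 2" "w$2 = cnj (w$2) * w$3" "cmod (w$3) = 1"
     "(cmod (w$1))\<^sup>2 = 1 - (cmod (w$2))\<^sup>2 / 4"
  using assms by (simp_all only: penta_boundary_def mem_Collect_eq)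

lemma Gamma_boundaryI:
  assumes "cmod (w$1) \<le> 2" "w$1 = cnj (w$1) * w$2" "cmod (w$2) = 1"
  shows "w \<in> Gamma_boundary"
  unfolding Gamma_boundary_def mem_Collect_eq using assms by (intro conjI)

lemma penta_boundaryI:
  assumes "cmod (w$2) \<le> 2" "w$2 = cnj (w$2) * w$3" "cmod (w$3) = 1"
     "(cmod (w$1))\<^sup>2 = 1 - (cmod (w$2))\<^sup>2 / 4"
  shows "w \<in> penta_boundary"
  unfolding penta_boundary_def mem_Collect_eq using assms by (intro conjI)

text \<open>The determinant \<open>p\<close> being unimodular forces \<open>d = p * cnj a\<close>.
  Hence the trace satisfies the conjugation relation, and \<open>cmod d = cmod a\<close> gives
  \<open>cmod (a + d) \<le> 2 * cmod a\<close>; the loss in this triangle inequality is why the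
  corner is only bounded, not determined in modulus.\<close>

lemma contraction_boundary_values:
  assumes "bounded_matrix 1 a b c d" "cmod (a * d - b * c) = 1"
  shows "cmod (a + d) \<le> 2" "a + d = cnj (a + d) * (a * d - b * c)"
    "(cmod c)\<^sup>2 \<le> 1 - (cmod (a + d))\<^sup>2 / 4"
proof -
  define p where "p = a * d - b * c"
  have d: "d = p * cnj a" and p: "cmod p = 1" and ac: "(cmod a)\<^sup>2 + (cmod c)\<^sup>2 \<le> 1"
    using contraction_det_unimodular[OF assms(1)] assms(2) unfolding p_def by auto
  have pp: "p * cnj p = 1" using p by (simp add: complex_norm_square[symmetric])
  show "a + d = cnj (a + d) * (a * d - b * c)"
    unfolding p_def[symmetric] unfolding d using pp by (simp add: algebra_simps)
  have "cmod (a + d) \<le> cmod a + cmod d" by (rule norm_triangle_ineq)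
  also have "cmod d = cmod a" unfolding d using p by (simp add: norm_mult)
  finally have s: "cmod (a + d) \<le> 2 * cmod a" by simp
  have "(cmod a)\<^sup>2 \<le> 1\<^sup>2" using ac zero_le_power2[of "cmod c"] unfolding one_power2 by linarith
  then have "cmod a \<le> 1" by (rule power2_le_imp_le) simp
  with s show "cmod (a + d) \<le> 2" by simp
  have "(cmod (a + d))\<^sup>2 \<le> (2 * cmod a)\<^sup>2" using s by (intro power_mono) auto
  then show "(cmod c)\<^sup>2 \<le> 1 - (cmod (a + d))\<^sup>2 / 4"
    using ac by (simp add: power_mult_distrib)
qed

text \<open>Equal diagonal entries \<open>s/2\<close> make the corner as large as the trace permits.
  The relation \<open>s = cnj s * p\<close> reads \<open>p * cnj (s/2) = s/2\<close>, so the unitary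
  matrix with first column \<open>(s/2, a)\<close> and determinant \<open>p\<close> indeed has
  \<open>s/2\<close> in both places.\<close>

lemma penta_boundary_matrix:
  assumes "cmod p = 1" "s = cnj s * p" "(cmod a)\<^sup>2 = 1 - (cmod s)\<^sup>2 / 4"
  shows "bounded_matrix 1 (s/2) (- p * cnj a) a (s/2)" "s/2 * (s/2) - (- p * cnj a) * a = p"
proof -
  have "p * cnj (s/2) = (cnj s * p) / 2" by simp
  then have *: "p * cnj (s/2) = s/2" unfolding assms(2)[symmetric] .
  have "(cmod (s/2))\<^sup>2 + (cmod a)\<^sup>2 = 1" using assms(3) by (simp add: norm_divide power_divide)
  from unitary_bounded_matrix[OF this assms(1)]
  show "bounded_matrix 1 (s/2) (- p * cnj a) a (s/2)" "s/2 * (s/2) - (- p * cnj a) * a = p"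
    unfolding * .
qed

lemma penta_boundary_subset: "penta_boundary \<subseteq> closure pentablock"
proof
  fix w assume "w \<in> penta_boundary"
  note w = penta_boundaryD[OF this]
  have 1: "bounded_matrix 1 (w$2/2) (- w$3 * cnj (w$1)) (w$1) (w$2/2)"
    and 2: "w$2/2 * (w$2/2) - (- w$3 * cnj (w$1)) * w$1 = w$3"
    by (rule penta_boundary_matrix[OF w(3,2,4)])+
  have "w = vector [w$1, w$2/2 + w$2/2, w$2/2 * (w$2/2) - (- w$3 * cnj (w$1)) * w$1]"
    unfolding 2 by (simp add: vec_eq_iff forall_3)
  with 1 have "\<exists>a b c d. bounded_matrix 1 a b c d \<and> w = vector [c, a + d, a * d - b * c]"
    by (rule_tac x="w$2/2" in exI, rule_tac x="- w$3 * cnj (w$1)" in exI, rule_tac x="w$1" in exI,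
        rule_tac x="w$2/2" in exI) (rule conjI)
  then show "w \<in> closure pentablock" by (rule iffD2[OF closure_pentablock_iff])
qed

text \<open>Lets the inclusion of \<open>Gamma_boundary\<close> in the closed symmetrized bidisc be
  inherited from the pentablock by dropping the first coordinate.\<close>

lemma Gamma_boundary_lift:
  fixes w :: "complex^2"
  assumes w: "w \<in> Gamma_boundary"
  shows "vector [of_real (sqrt (1 - (cmod (w$1))\<^sup>2 / 4)), w$1, w$2] \<in> penta_boundary"
proof (rule penta_boundaryI, unfold vector_3)
  have "(cmod (w$1))\<^sup>2 \<le> 2\<^sup>2"
    using Gamma_boundaryD(1)[OF w] by (intro power_mono) auto
  then show "(cmod (of_real (sqrt (1 - (cmod (w$1))\<^sup>2 / 4))))\<^sup>2 = 1 - (cmod (w$1))\<^sup>2 / 4" by simp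
qed (rule Gamma_boundaryD[OF w])+
lemma closure_pentablock_project:
  fixes w :: "complex^3"
  assumes "w \<in> closure pentablock"
  shows "vector [w$2, w$3] \<in> closure sym_bidisc"
proof -
  obtain a b c d where "bounded_matrix 1 a b c d" "w = vector [c, a + d, a * d - b * c]"
    using assms unfolding closure_pentablock_iff by blast
  then show ?thesis unfolding closure_sym_bidisc_iff
    by (intro exI[of _ a] exI[of _ b] exI[of _ c] exI[of _ d]) simp
qed

lemma Gamma_boundary_subset: "Gamma_boundary \<subseteq> closure sym_bidisc"
proof
  fix w assume "w \<in> Gamma_boundary"
  from closure_pentablock_project[OF subsetD[OF penta_boundary_subset Gamma_boundary_lift[OF this]]]
  have "vector [w$1, w$2] \<in> closure sym_bidisc" by simp
  moreover have "w = vector [w$1, w$2]" by (simp add: vec_eq_iff forall_2)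
  ultimately show "w \<in> closure sym_bidisc" by simp
qed

lemma closed_Gamma_boundary: "closed Gamma_boundary"
  unfolding Gamma_boundary_def by (intro closed_Collect_conj closed_Collect_le closed_Collect_eq continuous_intros)

lemma closed_penta_boundary: "closed penta_boundary"
  unfolding penta_boundary_def by (intro closed_Collect_conj closed_Collect_le closed_Collect_eq continuous_intros) simp_all

section \<open>Singular values and unitary conjugation of 2 by 2 matrices\<close>

lemma complex_quadratic_root:
  fixes a b c :: complex
  assumes "a \<noteq> 0"
  obtains z where "a * z\<^sup>2 + b * z + c = 0"
proof -
  obtain z where "poly [:c, b, a:] z = 0"
    using complex_poly_root[of "[:c, b, a:]"] assms by auto
  then have "a * z\<^sup>2 + b * z + c = 0" by (simp add: algebra_simps power2_eq_square)
  then show thesis by (rule that)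
qed

lemma normalized_pair:
  assumes "N\<^sup>2 = (cmod x)\<^sup>2 + (cmod y)\<^sup>2" "N \<noteq> 0"
  shows "(cmod (x / of_real N))\<^sup>2 + (cmod (y / of_real N))\<^sup>2 = 1"
proof -
  have "(cmod (x / of_real N))\<^sup>2 + (cmod (y / of_real N))\<^sup>2 = ((cmod x)\<^sup>2 + (cmod y)\<^sup>2) / N\<^sup>2"
    by (simp only: norm_divide power_divide norm_of_real power2_abs add_divide_distrib)
  then show ?thesis unfolding assms(1)[symmetric] using assms(2) by simp
qed

text \<open>A complex binary quadratic form has a projective zero: \<open>(1, 0)\<close> if the
  leading coefficient vanishes, else \<open>(z, 1)\<close> for a root \<open>z\<close>. This will
  produce the singular vectors.\<close>

lemma quadratic_form_unit_zero:
  fixes a b c :: complex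
  obtains x y where "a * x\<^sup>2 + b * x * y + c * y\<^sup>2 = 0" "(cmod x)\<^sup>2 + (cmod y)\<^sup>2 = 1"
proof (cases "a = 0")
  case True
  then show thesis using that[of 1 0] by simp
next
  case False
  then obtain z where z: "a * z\<^sup>2 + b * z + c = 0" by (rule complex_quadratic_root)
  define N where "N = sqrt ((cmod z)\<^sup>2 + 1)"
  have N: "N > 0" "N\<^sup>2 = (cmod z)\<^sup>2 + 1"
    by (simp_all add: N_def add_nonneg_pos)
  let ?x = "z / of_real N" and ?y = "1 / of_real N"
  have "a * ?x\<^sup>2 + b * ?x * ?y + c * ?y\<^sup>2 = (a * z\<^sup>2 + b * z + c) / (of_real N)\<^sup>2"
    by (simp add: add_divide_distrib power_divide power2_eq_square)
  moreover have "(cmod ?x)\<^sup>2 + (cmod ?y)\<^sup>2 = 1"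
    using N by (intro normalized_pair) auto
  ultimately show thesis by (intro that[of ?x ?y]) (simp_all add: z)
qed

text \<open>In two dimensions the complement of a unit vector \<open>(x, y)\<close> is spanned by
  \<open>(- cnj y, cnj x)\<close>. The unit vector is read off from \<open>p\<close>, or from
  \<open>q\<close> when \<open>p\<close> is zero, or chosen freely when both are.\<close>

lemma orthogonal_pair_form:
  fixes p1 p2 q1 q2 :: complex
  assumes orth: "p1 * cnj q1 + p2 * cnj q2 = 0"
  obtains x y u v where "(cmod x)\<^sup>2 + (cmod y)\<^sup>2 = 1" "p1 = u * x" "p2 = u * y" "q1 = - v * cnj y" "q2 = v * cnj x"
proof -
  define P where "P = sqrt ((cmod p1)\<^sup>2 + (cmod p2)\<^sup>2)"
  define Q where "Q = sqrt ((cmod q1)\<^sup>2 + (cmod q2)\<^sup>2)"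
  have P2: "P\<^sup>2 = (cmod p1)\<^sup>2 + (cmod p2)\<^sup>2" and Q2: "Q\<^sup>2 = (cmod q1)\<^sup>2 + (cmod q2)\<^sup>2"
    by (simp_all add: P_def Q_def)
  consider "P \<noteq> 0" | "P = 0" "Q \<noteq> 0" | "P = 0" "Q = 0" by blast
  then show thesis
  proof cases
    case 1
    let ?x = "p1 / of_real P" and ?y = "p2 / of_real P"
    let ?v = "q2 * ?x - q1 * ?y"
    have xy: "(cmod ?x)\<^sup>2 + (cmod ?y)\<^sup>2 = 1"
      by (rule normalized_pair[OF P2 1])
    have xyc: "?x * cnj ?x + ?y * cnj ?y = 1"
      unfolding complex_norm_square[symmetric] of_real_add[symmetric] xy by simp
    have "cnj (p1 * cnj q1 + p2 * cnj q2) = 0" using orth by simp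
    then have o: "cnj ?x * q1 + cnj ?y * q2 = 0"
      by (simp add: add_divide_distrib[symmetric])
    have "q1 = q1 * (?x * cnj ?x + ?y * cnj ?y) - ?x * (cnj ?x * q1 + cnj ?y * q2)"
      unfolding o xyc by simp
    also have "\<dots> = - ?v * cnj ?y" by (simp add: algebra_simps)
    finally have q1: "q1 = - ?v * cnj ?y" .
    have "q2 = q2 * (?x * cnj ?x + ?y * cnj ?y) - ?y * (cnj ?x * q1 + cnj ?y * q2)"
      unfolding o xyc by simp
    also have "\<dots> = ?v * cnj ?x" by (simp add: algebra_simps)
    finally have q2: "q2 = ?v * cnj ?x" .
    show thesis by (rule that[OF xy _ _ q1 q2, of "of_real P"]) (use 1 in simp_all)
  next
    case 2
    then have p: "p1 = 0" "p2 = 0" using P2 by (simp_all add: sum_power2_eq_zero_iff)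
    have "(cmod (cnj q2 / of_real Q))\<^sup>2 + (cmod (- cnj q1 / of_real Q))\<^sup>2 = 1"
      using 2 Q2 by (intro normalized_pair) simp_all
    then show thesis
      by (rule that[of _ _ 0 "of_real Q"]) (use 2 p in simp_all)
  next
    case 3
    then have "p1 = 0" "p2 = 0" "q1 = 0" "q2 = 0" using P2 Q2 by (simp_all add: sum_power2_eq_zero_iff)
    then show thesis by (intro that[of 1 0 0 0]) simp_all
  qed
qed

text \<open>A singular value decomposition whose singular values are allowed to be complex.\<close>

lemma singular_value_form:
  fixes a b c d :: complex
  obtains x y \<xi> \<eta> u v where "(cmod x)\<^sup>2 + (cmod y)\<^sup>2 = 1" "(cmod \<xi>)\<^sup>2 + (cmod \<eta>)\<^sup>2 = 1"
    "a = u * x * cnj \<xi> + v * cnj y * \<eta>" "b = u * x * cnj \<eta> - v * cnj y * \<xi>"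
    "c = u * y * cnj \<xi> - v * cnj x * \<eta>" "d = u * y * cnj \<eta> + v * cnj x * \<xi>"
proof -
  \<comment> \<open>The form is the inner product of the images of the orthonormal vectors
    \<open>(\<xi>, \<eta>)\<close> and \<open>(- cnj \<eta>, cnj \<xi>)\<close>. Conjugating the
    second image removes all conjugates of \<open>\<xi>\<close> and \<open>\<eta>\<close>, so
    orthogonality of the images is a genuine quadratic equation.\<close>
  obtain \<xi> \<eta> where q: "(a * cnj b + c * cnj d) * \<xi>\<^sup>2
      + (b * cnj b - a * cnj a + (d * cnj d - c * cnj c)) * \<xi> * \<eta> + (- (b * cnj a) - d * cnj c) * \<eta>\<^sup>2 = 0"
    and n: "(cmod \<xi>)\<^sup>2 + (cmod \<eta>)\<^sup>2 = 1"
    using quadratic_form_unit_zero by blast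
  have nc: "\<xi> * cnj \<xi> + \<eta> * cnj \<eta> = 1"
    unfolding complex_norm_square[symmetric] of_real_add[symmetric] n by simp
  let ?p1 = "a * \<xi> + b * \<eta>" and ?p2 = "c * \<xi> + d * \<eta>"
  let ?q1 = "- a * cnj \<eta> + b * cnj \<xi>" and ?q2 = "- c * cnj \<eta> + d * cnj \<xi>"
  have "?p1 * cnj ?q1 + ?p2 * cnj ?q2 = 0"
    unfolding q[symmetric] by (simp add: algebra_simps power2_eq_square)
  then obtain x y u v where *: "(cmod x)\<^sup>2 + (cmod y)\<^sup>2 = 1" "?p1 = u * x" "?p2 = u * y"
    "?q1 = - v * cnj y" "?q2 = v * cnj x"
    by (rule orthogonal_pair_form)
  have inv: "z = (z * \<xi> + w * \<eta>) * cnj \<xi> - (- z * cnj \<eta> + w * cnj \<xi>) * \<eta>"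
    "w = (z * \<xi> + w * \<eta>) * cnj \<eta> + (- z * cnj \<eta> + w * cnj \<xi>) * \<xi>" for z w
  proof -
    have "(z * \<xi> + w * \<eta>) * cnj \<xi> - (- z * cnj \<eta> + w * cnj \<xi>) * \<eta> = z * (\<xi> * cnj \<xi> + \<eta> * cnj \<eta>)"
      by (simp add: algebra_simps)
    then show "z = (z * \<xi> + w * \<eta>) * cnj \<xi> - (- z * cnj \<eta> + w * cnj \<xi>) * \<eta>" unfolding nc by simp
    have "(z * \<xi> + w * \<eta>) * cnj \<eta> + (- z * cnj \<eta> + w * cnj \<xi>) * \<xi> = w * (\<xi> * cnj \<xi> + \<eta> * cnj \<eta>)"
      by (simp add: algebra_simps)
    then show "w = (z * \<xi> + w * \<eta>) * cnj \<eta> + (- z * cnj \<eta> + w * cnj \<xi>) * \<xi>" unfolding nc by simp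
  qed
  show thesis
  proof (rule that[OF *(1) n])
    show "a = u * x * cnj \<xi> + v * cnj y * \<eta>" by (subst inv(1)[of a b]) (simp only: *, simp)
    show "b = u * x * cnj \<eta> - v * cnj y * \<xi>" by (subst inv(2)[of b a]) (simp only: *, simp)
    show "c = u * y * cnj \<xi> - v * cnj x * \<eta>" by (subst inv(1)[of c d]) (simp only: *)
    show "d = u * y * cnj \<eta> + v * cnj x * \<xi>" by (subst inv(2)[of d c]) (simp only: *)
  qed
qed

lemma orthonormal_pair_norm:
  assumes "(cmod x)\<^sup>2 + (cmod y)\<^sup>2 = 1"
  shows "(cmod (x * s - cnj y * t))\<^sup>2 + (cmod (y * s + cnj x * t))\<^sup>2 = (cmod s)\<^sup>2 + (cmod t)\<^sup>2"
proof -
  have "x * cnj x + y * cnj y = 1"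
    unfolding complex_norm_square[symmetric] of_real_add[symmetric] assms by simp
  moreover have "(x * s - cnj y * t) * cnj (x * s - cnj y * t) + (y * s + cnj x * t) * cnj (y * s + cnj x * t)
      = (x * cnj x + y * cnj y) * (s * cnj s + t * cnj t)"
    by (simp add: algebra_simps)
  ultimately have "(x * s - cnj y * t) * cnj (x * s - cnj y * t) + (y * s + cnj x * t) * cnj (y * s + cnj x * t)
      = s * cnj s + t * cnj t" by simp
  then show ?thesis
    unfolding complex_norm_square[symmetric] of_real_add[symmetric] of_real_eq_iff .
qed

text \<open>The matrix is \<open>U * diag(u, v) * V\<close> with \<open>U\<close> having columns
  \<open>(x, y)\<close>, \<open>(- cnj y, cnj x)\<close> and \<open>V\<close> having rows
  \<open>(cnj \<xi>, cnj \<eta>)\<close>, \<open>(- \<eta>, \<xi>)\<close>. Both are unitary of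
  determinant one, so norm and determinant are those of the diagonal factor.\<close>

lemma singular_value_form_norm:
  assumes xy: "(cmod x)\<^sup>2 + (cmod y)\<^sup>2 = 1" and n: "(cmod \<xi>)\<^sup>2 + (cmod \<eta>)\<^sup>2 = 1"
    and abcd: "a = u * x * cnj \<xi> + v * cnj y * \<eta>" "b = u * x * cnj \<eta> - v * cnj y * \<xi>"
    "c = u * y * cnj \<xi> - v * cnj x * \<eta>" "d = u * y * cnj \<eta> + v * cnj x * \<xi>"
  shows "bounded_matrix r a b c d \<longleftrightarrow> cmod u \<le> \<bar>r\<bar> \<and> cmod v \<le> \<bar>r\<bar>"
    and "a * d - b * c = u * v"
proof -
  have norm: "(cmod (a * s + b * t))\<^sup>2 + (cmod (c * s + d * t))\<^sup>2
      = (cmod u)\<^sup>2 * (cmod (cnj \<xi> * s + cnj \<eta> * t))\<^sup>2 + (cmod v)\<^sup>2 * (cmod (- \<eta> * s + \<xi> * t))\<^sup>2" for s t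
  proof -
    have "a * s + b * t = x * (u * (cnj \<xi> * s + cnj \<eta> * t)) - cnj y * (v * (- \<eta> * s + \<xi> * t))"
      "c * s + d * t = y * (u * (cnj \<xi> * s + cnj \<eta> * t)) + cnj x * (v * (- \<eta> * s + \<xi> * t))"
      unfolding abcd by (simp_all add: algebra_simps)
    then show ?thesis using orthonormal_pair_norm[OF xy] by (simp add: norm_mult power_mult_distrib)
  qed
  have n': "(cmod (cnj \<xi> * s + cnj \<eta> * t))\<^sup>2 + (cmod (- \<eta> * s + \<xi> * t))\<^sup>2 = (cmod s)\<^sup>2 + (cmod t)\<^sup>2" for s t
    using orthonormal_pair_norm[of "cnj \<xi>" "- \<eta>" s t] n by simp
  have nc: "\<xi> * cnj \<xi> + \<eta> * cnj \<eta> = 1"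
    unfolding complex_norm_square[symmetric] of_real_add[symmetric] n by simp
  show "bounded_matrix r a b c d \<longleftrightarrow> cmod u \<le> \<bar>r\<bar> \<and> cmod v \<le> \<bar>r\<bar>"
  proof
    assume *: "bounded_matrix r a b c d"
    have "cnj \<xi> * \<xi> + cnj \<eta> * \<eta> = 1" "- \<eta> * \<xi> + \<xi> * \<eta> = 0"
      "cnj \<xi> * - cnj \<eta> + cnj \<eta> * cnj \<xi> = 0" "- \<eta> * - cnj \<eta> + \<xi> * cnj \<xi> = 1"
      using nc by (simp_all add: algebra_simps)
    then have "(cmod u)\<^sup>2 \<le> r\<^sup>2" "(cmod v)\<^sup>2 \<le> r\<^sup>2"
      using *[unfolded bounded_matrix_def norm, rule_format, of \<xi> \<eta>]
        *[unfolded bounded_matrix_def norm, rule_format, of "- cnj \<eta>" "cnj \<xi>"] n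
      by (simp_all add: add.commute)
    then show "cmod u \<le> \<bar>r\<bar> \<and> cmod v \<le> \<bar>r\<bar>" by (simp add: abs_le_square_iff[symmetric])
  next
    assume "cmod u \<le> \<bar>r\<bar> \<and> cmod v \<le> \<bar>r\<bar>"
    then have uv: "(cmod u)\<^sup>2 \<le> r\<^sup>2" "(cmod v)\<^sup>2 \<le> r\<^sup>2" by (simp_all add: abs_le_square_iff[symmetric])
    show "bounded_matrix r a b c d" unfolding bounded_matrix_def norm
    proof (intro allI)
      fix s t
      have "(cmod u)\<^sup>2 * (cmod (cnj \<xi> * s + cnj \<eta> * t))\<^sup>2 + (cmod v)\<^sup>2 * (cmod (- \<eta> * s + \<xi> * t))\<^sup>2
          \<le> r\<^sup>2 * (cmod (cnj \<xi> * s + cnj \<eta> * t))\<^sup>2 + r\<^sup>2 * (cmod (- \<eta> * s + \<xi> * t))\<^sup>2"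
        using uv by (intro add_mono mult_right_mono) auto
      also have "\<dots> = r\<^sup>2 * ((cmod s)\<^sup>2 + (cmod t)\<^sup>2)"
        unfolding distrib_left[symmetric] n' ..
      finally show "(cmod u)\<^sup>2 * (cmod (cnj \<xi> * s + cnj \<eta> * t))\<^sup>2 + (cmod v)\<^sup>2 * (cmod (- \<eta> * s + \<xi> * t))\<^sup>2
          \<le> r\<^sup>2 * ((cmod s)\<^sup>2 + (cmod t)\<^sup>2)" .
    qed
  qed
  have xyc: "x * cnj x + y * cnj y = 1"
    unfolding complex_norm_square[symmetric] of_real_add[symmetric] xy by simp
  have "a * d - b * c = u * v * (x * cnj x + y * cnj y) * (\<xi> * cnj \<xi> + \<eta> * cnj \<eta>)"
    unfolding abcd by (simp add: algebra_simps)
  then show "a * d - b * c = u * v" unfolding xyc nc by simp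
qed

text \<open>Conjugating by unitaries moves the lower left entry continuously to zero (Schur form), which
  realises every smaller modulus on the way.\<close>

lemma shrink_corner:
  assumes A: "bounded_matrix 1 a b c d" and k: "cmod k \<le> 1"
  obtains a' b' d' where "bounded_matrix 1 a' b' (k * c) d'" "a' + d' = a + d"
    "a' * d' - b' * (k * c) = a * d - b * c"
proof (cases "c = 0")
  case True
  then show thesis using that[of a b d] A by simp
next
  case False
  obtain z where z: "c * z\<^sup>2 + (d - a) * z + (- b) = 0"
    using complex_quadratic_root[OF False] by blast
  \<comment> \<open>The vector \<open>(v t, t)\<close> moves from \<open>(1, 0)\<close> to
    \<open>(z, 1)\<close>, which is an eigenvector by the choice of \<open>z\<close>, and it avoids
    the origin because \<open>v 0 = 1\<close>. Normalised, it is the first vector of an orthonormal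
    basis in which the corner entry is \<open>q t / (N t)^2\<close>: it starts at \<open>c\<close>
    and ends at zero.\<close>
  define v where "v t = (1 - of_real t) + of_real t * z" for t :: real
  define N where "N t = sqrt ((cmod (v t))\<^sup>2 + t\<^sup>2)" for t
  define q where "q t = c * (v t)\<^sup>2 + (d - a) * v t * of_real t - b * (of_real t)\<^sup>2" for t
  have N2: "(N t)\<^sup>2 = (cmod (v t))\<^sup>2 + t\<^sup>2" for t by (simp add: N_def)
  have N0: "N t \<noteq> 0" for t
    by (cases "t = 0") (auto simp: N_def v_def sum_power2_eq_zero_iff)
  have cont: "continuous_on {0..1} (\<lambda>t. cmod (q t / (of_real (N t))\<^sup>2))"
    unfolding q_def N_def v_def using N0[unfolded N_def v_def]
    by (intro continuous_intros) auto
  have "q 1 = 0" unfolding q_def using z by (simp add: v_def)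
  have "\<exists>t\<ge>0. t \<le> 1 \<and> cmod (q t / (of_real (N t))\<^sup>2) = cmod (k * c)"
  proof (rule IVT2'[OF _ _ _ cont])
    show "cmod (q 1 / (of_real (N 1))\<^sup>2) \<le> cmod (k * c)" using \<open>q 1 = 0\<close> by simp
    have "cmod k * cmod c \<le> 1 * cmod c" using k by (intro mult_right_mono) auto
    then show "cmod (k * c) \<le> cmod (q 0 / (of_real (N 0))\<^sup>2)"
      by (simp add: q_def N_def v_def norm_mult)
  qed simp
  then obtain t where t: "cmod (q t / (of_real (N t))\<^sup>2) = cmod (k * c)" by blast
  define x where "x = v t / of_real (N t)"
  define y where "y = of_real t / (of_real (N t) :: complex)"
  have xy: "(cmod x)\<^sup>2 + (cmod y)\<^sup>2 = 1"
    unfolding x_def y_def using N0[of t] N2[of t] by (intro normalized_pair) simp_all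
  have xyc: "x * cnj x + y * cnj y = 1"
    unfolding complex_norm_square[symmetric] of_real_add[symmetric] xy by simp
  define a1 where "a1 = cnj x * (a * x + b * y) + cnj y * (c * x + d * y)"
  define b1 where "b1 = cnj x * (- a * cnj y + b * cnj x) + cnj y * (- c * cnj y + d * cnj x)"
  define c1 where "c1 = - y * (a * x + b * y) + x * (c * x + d * y)"
  define d1 where "d1 = - y * (- a * cnj y + b * cnj x) + x * (- c * cnj y + d * cnj x)"
  have "c1 = q t / (of_real (N t))\<^sup>2"
    unfolding c1_def x_def y_def q_def using N0[of t]
    by (simp add: field_simps power2_eq_square)
  then have c1: "cmod c1 = cmod (k * c)" using t by simp
  have bm: "bounded_matrix 1 a1 b1 c1 d1" unfolding bounded_matrix_def
  proof (intro allI)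
    fix s t
    let ?s = "x * s - cnj y * t" and ?t = "y * s + cnj x * t"
    have "a1 * s + b1 * t = cnj x * (a * ?s + b * ?t) - cnj (- y) * (c * ?s + d * ?t)"
      "c1 * s + d1 * t = (- y) * (a * ?s + b * ?t) + cnj (cnj x) * (c * ?s + d * ?t)"
      unfolding a1_def b1_def c1_def d1_def by (simp_all add: algebra_simps)
    then have "(cmod (a1 * s + b1 * t))\<^sup>2 + (cmod (c1 * s + d1 * t))\<^sup>2
        = (cmod (a * ?s + b * ?t))\<^sup>2 + (cmod (c * ?s + d * ?t))\<^sup>2"
      using orthonormal_pair_norm[of "cnj x" "- y"] xy by simp
    also have "\<dots> \<le> 1\<^sup>2 * ((cmod ?s)\<^sup>2 + (cmod ?t)\<^sup>2)"
      using A unfolding bounded_matrix_def by blast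
    also have "(cmod ?s)\<^sup>2 + (cmod ?t)\<^sup>2 = (cmod s)\<^sup>2 + (cmod t)\<^sup>2"
      by (rule orthonormal_pair_norm[OF xy])
    finally show "(cmod (a1 * s + b1 * t))\<^sup>2 + (cmod (c1 * s + d1 * t))\<^sup>2 \<le> 1\<^sup>2 * ((cmod s)\<^sup>2 + (cmod t)\<^sup>2)" .
  qed
  have "a1 + d1 = (a + d) * (x * cnj x + y * cnj y)"
    unfolding a1_def d1_def by (simp add: algebra_simps)
  then have tr: "a1 + d1 = a + d" unfolding xyc by simp
  have "a1 * d1 - b1 * c1 = (a * d - b * c) * (x * cnj x + y * cnj y) * (x * cnj x + y * cnj y)"
    unfolding a1_def b1_def c1_def d1_def by (simp add: algebra_simps)
  then have det: "a1 * d1 - b1 * c1 = a * d - b * c" unfolding xyc by simp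
  \<comment> \<open>The intermediate value theorem matches only the modulus of the corner;
    conjugation by \<open>diag(1, u)\<close> corrects its argument and keeps trace, determinant and
    norm.\<close>
  obtain u where u: "cmod u = 1" "u * c1 = k * c"
  proof (cases "c1 = 0")
    case True
    then show thesis using that[of 1] c1 by simp
  next
    case False
    have "cmod (k * c / c1) = 1" unfolding norm_divide c1[symmetric] using False by simp
    then show thesis using False by (intro that[of "k * c / c1"]) simp_all
  qed
  have uu: "u * cnj u = 1" using u by (simp add: complex_norm_square[symmetric])
  show thesis
  proof (rule that[of a1 "cnj u * b1" d1])
    show "bounded_matrix 1 a1 (cnj u * b1) (k * c) d1" unfolding bounded_matrix_def
    proof (intro allI)
      fix s t
      have "k * c * s + d1 * t = u * (c1 * s + d1 * (cnj u * t))"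
        using u(2) uu by (simp add: algebra_simps)
      then have "(cmod (a1 * s + cnj u * b1 * t))\<^sup>2 + (cmod (k * c * s + d1 * t))\<^sup>2
        = (cmod (a1 * s + b1 * (cnj u * t)))\<^sup>2 + (cmod (c1 * s + d1 * (cnj u * t)))\<^sup>2"
        using u(1) by (simp add: norm_mult mult_ac)
      also have "\<dots> \<le> 1\<^sup>2 * ((cmod s)\<^sup>2 + (cmod (cnj u * t))\<^sup>2)"
        using bm unfolding bounded_matrix_def by blast
      also have "\<dots> = 1\<^sup>2 * ((cmod s)\<^sup>2 + (cmod t)\<^sup>2)" using u(1) by (simp add: norm_mult)
      finally show "(cmod (a1 * s + cnj u * b1 * t))\<^sup>2 + (cmod (k * c * s + d1 * t))\<^sup>2
        \<le> 1\<^sup>2 * ((cmod s)\<^sup>2 + (cmod t)\<^sup>2)" .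
    qed
    show "a1 + d1 = a + d" by (fact tr)
    have "cnj u * b1 * (k * c) = (u * cnj u) * (b1 * c1)" unfolding u(2)[symmetric] by (simp add: mult_ac)
    then have "cnj u * b1 * (k * c) = b1 * c1" unfolding uu mult_1 .
    then show "a1 * d1 - cnj u * b1 * (k * c) = a * d - b * c" using det by (simp only:)
  qed
qed

section \<open>Distinguished boundaries\<close>

lemma complex_linear_iff:
  fixes f :: "complex^'n \<Rightarrow> complex"
  shows "Vector_Spaces.linear (*s) (*) f \<longleftrightarrow> (\<forall>x y. f (x + y) = f x + f y) \<and> (\<forall>c x. f (c *s x) = c * f x)"
  unfolding Vector_Spaces.linear_iff
  using vec.vector_space_axioms vector_space_over_itself.vector_space_axioms by blast

lemma holomorphic_on_vec_const: "holomorphic_on_vec (\<lambda>z. c) S"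
  unfolding holomorphic_on_vec_def complex_linear_iff
  by (intro ballI exI[of _ "\<lambda>z. 0"] conjI) (auto intro: derivative_intros)

lemma holomorphic_on_vec_nth: "holomorphic_on_vec (\<lambda>z. z $ i) S"
  unfolding holomorphic_on_vec_def complex_linear_iff
  by (intro ballI exI[of _ "\<lambda>z. z $ i"] conjI bounded_linear_imp_has_derivative) auto

lemma holomorphic_on_vec_add:
  assumes "holomorphic_on_vec f S" "holomorphic_on_vec g S"
  shows "holomorphic_on_vec (\<lambda>z. f z + g z) S"
  unfolding holomorphic_on_vec_def
proof
  fix z assume "z \<in> S"
  then obtain f' g' where *: "(f has_derivative f') (at z)" "Vector_Spaces.linear (*s) (*) f'"
    "(g has_derivative g') (at z)" "Vector_Spaces.linear (*s) (*) g'"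
    using assms unfolding holomorphic_on_vec_def by blast
  show "\<exists>h'. ((\<lambda>z. f z + g z) has_derivative h') (at z) \<and> Vector_Spaces.linear (*s) (*) h'"
    using * unfolding complex_linear_iff
    by (intro exI[of _ "\<lambda>h. f' h + g' h"] conjI has_derivative_add) (auto simp: algebra_simps)
qed

lemma holomorphic_on_vec_mult:
  assumes "holomorphic_on_vec f S" "holomorphic_on_vec g S"
  shows "holomorphic_on_vec (\<lambda>z. f z * g z) S"
  unfolding holomorphic_on_vec_def
proof
  fix z assume "z \<in> S"
  then obtain f' g' where *: "(f has_derivative f') (at z)" "Vector_Spaces.linear (*s) (*) f'"
    "(g has_derivative g') (at z)" "Vector_Spaces.linear (*s) (*) g'"
    using assms unfolding holomorphic_on_vec_def by blast
  show "\<exists>h'. ((\<lambda>z. f z * g z) has_derivative h') (at z) \<and> Vector_Spaces.linear (*s) (*) h'"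
    using * unfolding complex_linear_iff
    by (intro exI[of _ "\<lambda>h. f z * g' h + f' h * g z"] conjI has_derivative_mult) (auto simp: algebra_simps)
qed

lemma holomorphic_on_vec_power:
  assumes "holomorphic_on_vec f S"
  shows "holomorphic_on_vec (\<lambda>z. f z ^ n) S"
  by (induction n) (simp_all add: holomorphic_on_vec_const holomorphic_on_vec_mult assms)

text \<open>Complex linearity of the derivative of \<open>f\<close> pulls the scalar out of
  \<open>f' (h *s v)\<close>, where \<open>v\<close> collects the derivatives of the coordinates, so
  the composite has the complex derivative \<open>f' v\<close>.\<close>

lemma holomorphic_on_vec_compose:
  fixes \<gamma> :: "complex \<Rightarrow> complex^'d"
  assumes f: "holomorphic_on_vec f \<Omega>" and S: "open S"
    and \<gamma>: "\<And>i. (\<lambda>z. \<gamma> z $ i) holomorphic_on S" "\<And>z. z \<in> S \<Longrightarrow> \<gamma> z \<in> \<Omega>"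
  shows "(\<lambda>z. f (\<gamma> z)) holomorphic_on S"
proof (rule holomorphic_onI)
  fix z assume z: "z \<in> S"
  obtain f' where f': "(f has_derivative f') (at (\<gamma> z))" "\<And>c x. f' (c *s x) = c * f' x"
    using f \<gamma>(2)[OF z] unfolding holomorphic_on_vec_def complex_linear_iff by blast
  define v where "v = (\<chi> i. deriv (\<lambda>z. \<gamma> z $ i) z)"
  have D: "((\<lambda>z. \<gamma> z $ i) has_field_derivative v $ i) (at z)" for i
    by (simp add: v_def) (rule holomorphic_derivI[OF \<gamma>(1) S z])
  have "(\<gamma> has_derivative (\<lambda>h. h *s v)) (at z)"
    unfolding has_derivative_at
  proof
    have "linear (\<lambda>h. h *s v)"
      by (intro linearI) (simp_all add: vec_eq_iff algebra_simps)
    then show "bounded_linear (\<lambda>h. h *s v)" by (simp add: linear_conv_bounded_linear)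
    have "((\<lambda>h. (\<gamma> (z + h) $ i - \<gamma> z $ i - v $ i * h) /\<^sub>R norm h) \<longlongrightarrow> 0) (at 0)" for i
    proof (rule tendsto_norm_zero_cancel)
      show "((\<lambda>h. norm ((\<gamma> (z + h) $ i - \<gamma> z $ i - v $ i * h) /\<^sub>R norm h)) \<longlongrightarrow> 0) (at 0)"
        using D[of i] unfolding has_field_derivative_def has_derivative_at
        by (simp add: divide_inverse mult.commute)
    qed
    then have "((\<lambda>h. (\<gamma> (z + h) - \<gamma> z - h *s v) /\<^sub>R norm h) \<longlongrightarrow> 0) (at 0)"
      by (intro vec_tendstoI) (simp add: mult.commute)
    then have "((\<lambda>h. norm ((\<gamma> (z + h) - \<gamma> z - h *s v) /\<^sub>R norm h)) \<longlongrightarrow> 0) (at 0)"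
      by (rule tendsto_norm_zero)
    then show "(\<lambda>h. norm (\<gamma> (z + h) - \<gamma> z - h *s v) / norm h) \<midarrow>0\<rightarrow> 0"
      by (simp add: divide_inverse mult.commute)
  qed
  from has_derivative_compose[OF this f'(1)]
  have "((\<lambda>z. f (\<gamma> z)) has_derivative (\<lambda>h. f' v * h)) (at z)"
    by (simp add: f'(2) mult.commute)
  then have "((\<lambda>z. f (\<gamma> z)) has_field_derivative f' v) (at z)"
    by (simp add: has_field_derivative_def)
  then show "(\<lambda>z. f (\<gamma> z)) field_differentiable at z within S"
    using field_differentiable_at_within field_differentiable_def by blast
qed

text \<open>If \<open>g\<close> has modulus at most one and \<open>h\<close> is small wherever \<open>\<bar>g\<bar> = 1\<close>, a high power of \<open>g\<close>
  times \<open>h\<close> is small everywhere.\<close>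

lemma power_peak:
  fixes g h :: "'a::topological_space \<Rightarrow> complex"
  assumes K: "compact K" and cont: "continuous_on K g" "continuous_on K h"
    and g: "\<And>w. w \<in> K \<Longrightarrow> cmod (g w) \<le> 1"
    and gh: "\<And>w. w \<in> K \<Longrightarrow> cmod (g w) < 1 \<or> cmod (h w) < 1"
  obtains N where "\<And>w. w \<in> K \<Longrightarrow> cmod (g w ^ N * h w) < 1"
proof (cases "\<forall>w\<in>K. cmod (h w) < 1")
  case True
  then show thesis using that[of 0] by simp
next
  case False
  \<comment> \<open>Only where \<open>cmod (h w) \<ge> 1\<close> does \<open>g\<close> have to help.
    There compactness gives \<open>cmod (g w) \<le> q < 1\<close> and
    \<open>cmod (h w) \<le> M\<close>, and a power of \<open>q\<close> below \<open>1 / M\<close>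
    suffices.\<close>
  define K1 where "K1 = K \<inter> (\<lambda>w. cmod (h w)) -` {1..}"
  have K1: "compact K1" "K1 \<noteq> {}" "K1 \<subseteq> K"
  proof -
    have "closedin (top_of_set K) K1"
      unfolding K1_def using cont by (intro continuous_closedin_preimage continuous_intros) auto
    then show "compact K1" using K by (simp add: closedin_compact)
  qed (use False in \<open>auto simp: K1_def not_less\<close>)
  have c1: "continuous_on K1 (\<lambda>w. cmod (g w))" "continuous_on K1 (\<lambda>w. cmod (h w))"
    using cont K1(3) by (auto intro!: continuous_intros intro: continuous_on_subset)
  obtain w1 where w1: "w1 \<in> K1" "\<And>w. w \<in> K1 \<Longrightarrow> cmod (g w) \<le> cmod (g w1)"
    using continuous_attains_sup[OF K1(1,2) c1(1)] by blast
  obtain w2 where w2: "w2 \<in> K1" "\<And>w. w \<in> K1 \<Longrightarrow> cmod (h w) \<le> cmod (h w2)"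
    using continuous_attains_sup[OF K1(1,2) c1(2)] by blast
  define q where "q = cmod (g w1)"
  define M where "M = cmod (h w2)"
  have q: "q < 1" "0 \<le> q" and M: "1 \<le> M" using w1(1) w2(1) gh by (force simp: K1_def q_def M_def)+
  obtain N where N: "q ^ N < 1 / M" using real_arch_pow_inv[of "1 / M" q] q M by auto
  show thesis
  proof (rule that[of N])
    fix w assume w: "w \<in> K"
    show "cmod (g w ^ N * h w) < 1"
    proof (cases "w \<in> K1")
      case True
      have "cmod (g w ^ N * h w) \<le> q ^ N * M"
        unfolding norm_mult norm_power q_def M_def
        using w1(2) w2(2) True by (intro mult_mono power_mono) auto
      also have "\<dots> < 1" using N M by (simp add: field_simps)
      finally show ?thesis .
    next
      case False
      then have "cmod (h w) < 1" using w by (auto simp: K1_def)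
      moreover have "cmod (g w) ^ N \<le> 1" using g[OF w] by (simp add: power_le_one)
      then have "cmod (g w) ^ N * cmod (h w) \<le> 1 * cmod (h w)" by (intro mult_right_mono) auto
      ultimately show ?thesis by (simp add: norm_mult norm_power)
    qed
  qed
qed

text \<open>Were \<open>w0\<close> missing from \<open>E\<close>, some \<open>g ^ N * h\<close>
  would have modulus below one on the compact set \<open>E\<close> but value one at
  \<open>w0\<close>. Two functions divide the work: \<open>g\<close> isolates the fibre with the
  right determinant, \<open>h\<close> the point inside it, and \<open>h\<close> may exceed one
  elsewhere.\<close>

lemma max_modulus_set_peak:
  assumes E: "max_modulus_set \<Omega> E" and cl: "compact (closure \<Omega>)" and w0: "w0 \<in> closure \<Omega>"
    and cont: "continuous_on (closure \<Omega>) g" "continuous_on (closure \<Omega>) h"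
    and hol: "holomorphic_on_vec g \<Omega>" "holomorphic_on_vec h \<Omega>"
    and one: "g w0 = 1" "h w0 = 1"
    and g: "\<And>w. w \<in> closure \<Omega> \<Longrightarrow> cmod (g w) \<le> 1"
    and gh: "\<And>w. w \<in> closure \<Omega> \<Longrightarrow> w \<noteq> w0 \<Longrightarrow> cmod (g w) < 1 \<or> cmod (h w) < 1"
  shows "w0 \<in> E"
proof (rule ccontr)
  assume "w0 \<notin> E"
  have EE: "closed E" "E \<subseteq> closure \<Omega>" using E by (auto simp: max_modulus_set_def)
  have "compact E" using EE cl by (metis compact_Int_closed inf.absorb_iff2)
  moreover have "continuous_on E g" "continuous_on E h" using cont EE(2) by (auto intro: continuous_on_subset)
  moreover have "cmod (g w) \<le> 1" if "w \<in> E" for w using g EE(2) that by blast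
  moreover have "cmod (g w) < 1 \<or> cmod (h w) < 1" if "w \<in> E" for w
    using gh EE(2) that \<open>w0 \<notin> E\<close> by blast
  ultimately obtain N where N: "\<And>w. w \<in> E \<Longrightarrow> cmod (g w ^ N * h w) < 1"
    using power_peak[of E g h] by blast
  have "continuous_on (closure \<Omega>) (\<lambda>w. g w ^ N * h w)" using cont by (intro continuous_intros)
  moreover have "holomorphic_on_vec (\<lambda>w. g w ^ N * h w) \<Omega>"
    using hol by (intro holomorphic_on_vec_mult holomorphic_on_vec_power)
  ultimately obtain z where z: "z \<in> E" "\<forall>w\<in>closure \<Omega>. cmod (g w ^ N * h w) \<le> cmod (g z ^ N * h z)"
    using E unfolding max_modulus_set_def by blast
  then have "1 \<le> cmod (g z ^ N * h z)" using w0 one by force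
  then show False using N[OF z(1)] by simp
qed

section \<open>Minimality of the expected boundaries through peak functions\<close>

lemma distinguished_boundaryI:
  assumes "max_modulus_set \<Omega> b" "\<And>E. max_modulus_set \<Omega> E \<Longrightarrow> b \<subseteq> E"
  shows "distinguished_boundary \<Omega> = b"
  unfolding distinguished_boundary_def using assms by (intro Least_equality) auto

lemma cmod_half_one_plus:
  assumes "cmod z \<le> 1"
  shows "cmod ((1 + z) / 2) \<le> 1" "z \<noteq> 1 \<Longrightarrow> cmod ((1 + z) / 2) < 1"
proof -
  have "cmod (1 + z) \<le> 1 + cmod z" using norm_triangle_ineq[of 1 z] by simp
  then show "cmod ((1 + z) / 2) \<le> 1" using assms by (simp add: norm_divide)
  assume "z \<noteq> 1"
  have "(cmod (1 + z))\<^sup>2 < 2\<^sup>2"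
  proof (rule ccontr)
    assume "\<not> ?thesis"
    moreover have n: "(Re z)\<^sup>2 + (Im z)\<^sup>2 \<le> 1"
      using assms power_mono[of "cmod z" 1 2] by (simp add: cmod_power2)
    moreover have "(cmod (1 + z))\<^sup>2 = 1 + 2 * Re z + ((Re z)\<^sup>2 + (Im z)\<^sup>2)"
      unfolding cmod_power2 by (simp add: power2_eq_square algebra_simps)
    ultimately have "Re z \<ge> 1" by simp
    then have "1\<^sup>2 \<le> (Re z)\<^sup>2" by (intro power_mono) auto
    then have "(Im z)\<^sup>2 \<le> 0" "(Re z)\<^sup>2 \<le> 1\<^sup>2" using n zero_le_power2[of "Im z"]
      unfolding one_power2 by linarith+
    then have "Im z = 0" by simp
    moreover have "Re z \<le> 1" using \<open>(Re z)\<^sup>2 \<le> 1\<^sup>2\<close> by (rule power2_le_imp_le) simp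
    moreover note \<open>Re z \<ge> 1\<close>
    ultimately have "z = 1" by (simp add: complex_eq_iff)
    with \<open>z \<noteq> 1\<close> show False by simp
  qed
  then have "cmod (1 + z) < 2" by (rule power2_less_imp_less) simp
  then show "cmod ((1 + z) / 2) < 1" by (simp add: norm_divide)
qed

lemma Gamma_boundary_subset_max_modulus_set:
  assumes E: "max_modulus_set sym_bidisc E"
  shows "Gamma_boundary \<subseteq> E"
proof
  fix w0 assume w0: "w0 \<in> Gamma_boundary"
  define s0 p0 where "s0 = w0 $ 1" and "p0 = w0 $ 2"
  have b: "cmod s0 \<le> 2" "s0 = cnj s0 * p0" "cmod p0 = 1"
    unfolding s0_def p0_def by (rule Gamma_boundaryD[OF w0])+
  have pp: "cnj p0 * p0 = 1" using b(3) complex_norm_square[of p0] by (simp add: mult.commute)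
  define g where "g w = (1 + cnj p0 * (w$2)) * (1/2)" for w :: "complex^2"
  \<comment> \<open>On the fibre \<open>p = p0\<close> the difference \<open>e = s - s0\<close>
    satisfies \<open>cnj p0 * e = cnj e\<close>, so \<open>cnj p0 * e^2\<close> is the real number
    \<open>(cmod e)^2\<close>. Since \<open>cmod e \<le> 4\<close>, dividing by
    \<open>16 = 4^2\<close> keeps \<open>h\<close> in \<open>[0, 1)\<close> for
    \<open>e \<noteq> 0\<close>.\<close>
  define h where "h w = 1 + (- cnj p0 / 16) * (w$1 + (- s0))\<^sup>2" for w :: "complex^2"
  show "w0 \<in> E"
  proof (rule max_modulus_set_peak[OF E compact_closure_sym_bidisc, of w0 g h])
    show "w0 \<in> closure sym_bidisc" using w0 Gamma_boundary_subset by blast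
    show "continuous_on (closure sym_bidisc) g" "continuous_on (closure sym_bidisc) h"
      unfolding g_def h_def by (intro continuous_intros)+
    show "holomorphic_on_vec g sym_bidisc" "holomorphic_on_vec h sym_bidisc"
      unfolding g_def h_def
      by (intro holomorphic_on_vec_add holomorphic_on_vec_mult holomorphic_on_vec_const
          holomorphic_on_vec_nth holomorphic_on_vec_power)+
    show "g w0 = 1" "h w0 = 1" using pp by (simp_all add: g_def h_def s0_def p0_def)
    fix w :: "complex^2" assume w: "w \<in> closure sym_bidisc"
    then obtain a b c d where A: "bounded_matrix 1 a b c d" "w = vector [a + d, a * d - b * c]"
      unfolding closure_sym_bidisc_iff by blast
    have p: "cmod (w $ 2) \<le> 1" using contraction_det_unimodular(3)[OF A(1)] A(2) by simp
    then have p': "cmod (cnj p0 * (w $ 2)) \<le> 1" using b(3) by (simp add: norm_mult)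
    show "cmod (g w) \<le> 1" using cmod_half_one_plus(1)[OF p'] by (simp add: g_def)
    assume "w \<noteq> w0"
    show "cmod (g w) < 1 \<or> cmod (h w) < 1"
    proof (cases "cnj p0 * (w $ 2) = 1")
      case False
      then show ?thesis using cmod_half_one_plus(2)[OF p'] by (simp add: g_def)
    next
      case True
      then have "(cnj p0 * p0) * (w $ 2) = p0" by (simp add: mult_ac)
      then have wp: "w $ 2 = p0" using pp by simp
      have w1: "w $ 1 = a + d" and p0: "p0 = a * d - b * c" using A(2) wp by simp_all
      have "cmod (a * d - b * c) = 1" using p0 b(3) by simp
      note bv = contraction_boundary_values[OF A(1) this]
      have s: "cmod (w $ 1) \<le> 2" "w $ 1 = cnj (w $ 1) * p0" unfolding w1 p0 by (rule bv)+
      have ne: "w $ 1 \<noteq> s0" using \<open>w \<noteq> w0\<close> wp by (auto simp: vec_eq_iff forall_2 s0_def p0_def)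
      define e where "e = w $ 1 - s0"
      have "cnj p0 * e = cnj e"
      proof -
        have "e = cnj e * p0" unfolding e_def by (subst s(2), subst b(2)) (simp add: algebra_simps)
        then have "cnj p0 * e = cnj p0 * (cnj e * p0)" by (rule arg_cong)
        also have "\<dots> = cnj e * (cnj p0 * p0)" by (simp only: mult_ac)
        finally show ?thesis unfolding pp by simp
      qed
      then have "(cnj p0 * e) * e = of_real ((cmod e)\<^sup>2)"
        unfolding complex_norm_square by (simp add: mult.commute)
      then have h: "h w = of_real (1 - (cmod e)\<^sup>2 / 16)" by (simp add: h_def e_def power2_eq_square mult.assoc)
      have "cmod e \<le> 4" using norm_triangle_ineq4[of "w $ 1" s0] s(1) b(1) by (simp add: e_def)
      then have "(cmod e)\<^sup>2 \<le> 4\<^sup>2" by (intro power_mono) auto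
      moreover have "(cmod e)\<^sup>2 > 0" using ne by (simp add: e_def)
      ultimately have "\<bar>1 - (cmod e)\<^sup>2 / 16\<bar> < 1" by simp
      then show ?thesis unfolding h norm_of_real by blast
    qed
  qed
qed

lemma penta_boundary_subset_max_modulus_set:
  assumes E: "max_modulus_set pentablock E"
  shows "penta_boundary \<subseteq> E"
proof
  fix w0 assume w0: "w0 \<in> penta_boundary"
  define a0 s0 p0 where "a0 = w0 $ 1" and "s0 = w0 $ 2" and "p0 = w0 $ 3"
  have b: "cmod s0 \<le> 2" "s0 = cnj s0 * p0" "cmod p0 = 1" "(cmod a0)\<^sup>2 = 1 - (cmod s0)\<^sup>2 / 4"
    unfolding a0_def s0_def p0_def by (rule penta_boundaryD[OF w0])+
  have pp: "cnj p0 * p0 = 1" using b(3) complex_norm_square[of p0] by (simp add: mult.commute)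
  \<comment> \<open>This is the inner product of \<open>(a, s/2)\<close> with the unit vector
    \<open>(a0, s0/2)\<close>, whence the factor \<open>1/4\<close>. On the fibre
    \<open>p = p0\<close> the vector \<open>(a, s/2)\<close> has norm at most one, so
    \<open>u = 1\<close> can occur only at \<open>w0\<close>.\<close>
  define u where "u = (\<lambda>w::complex^3. cnj a0 * (w$1) + (cnj s0 / 4) * (w$2))"
  define g where "g w = (1 + cnj p0 * (w$3)) * (1/2)" for w :: "complex^3"
  define h where "h w = (1 + u w) * (1/2)" for w :: "complex^3"
  show "w0 \<in> E"
  proof (rule max_modulus_set_peak[OF E compact_closure_pentablock, of w0 g h])
    show "w0 \<in> closure pentablock" using w0 penta_boundary_subset by blast
    show "continuous_on (closure pentablock) g" "continuous_on (closure pentablock) h"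
      unfolding g_def h_def u_def by (intro continuous_intros)+
    show "holomorphic_on_vec g pentablock" "holomorphic_on_vec h pentablock"
      unfolding g_def h_def u_def
      by (intro holomorphic_on_vec_add holomorphic_on_vec_mult holomorphic_on_vec_const
          holomorphic_on_vec_nth)+
    have "u w0 = of_real ((cmod a0)\<^sup>2 + (cmod s0)\<^sup>2 / 4)"
      unfolding of_real_add of_real_divide complex_norm_square by (simp add: u_def a0_def s0_def mult.commute)
    then have "u w0 = 1" using b(4) by simp
    then show "g w0 = 1" "h w0 = 1" using pp by (simp_all add: g_def h_def p0_def)
    fix w :: "complex^3" assume w: "w \<in> closure pentablock"
    then obtain a b c d where A: "bounded_matrix 1 a b c d" "w = vector [c, a + d, a * d - b * c]"
      unfolding closure_pentablock_iff by blast
    have p: "cmod (w $ 3) \<le> 1" using contraction_det_unimodular(3)[OF A(1)] A(2) by simp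
    then have p': "cmod (cnj p0 * (w $ 3)) \<le> 1" using b(3) by (simp add: norm_mult)
    show "cmod (g w) \<le> 1" using cmod_half_one_plus(1)[OF p'] by (simp add: g_def)
    assume "w \<noteq> w0"
    show "cmod (g w) < 1 \<or> cmod (h w) < 1"
    proof (cases "cnj p0 * (w $ 3) = 1")
      case False
      then show ?thesis using cmod_half_one_plus(2)[OF p'] by (simp add: g_def)
    next
      case True
      then have "(cnj p0 * p0) * (w $ 3) = p0" by (simp add: mult_ac)
      then have wp: "w $ 3 = p0" using pp by simp
      then have "cmod (a * d - b * c) = 1" using A(2) b(3) by simp
      from contraction_boundary_values(3)[OF A(1) this]
      have s: "(cmod (w $ 1))\<^sup>2 + (cmod (w $ 2))\<^sup>2 / 4 \<le> 1" using A(2) by simp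
      txt \<open>The equality case of Cauchy--Schwarz for \<open>(a, s/2)\<close> and \<open>(a0, s0/2)\<close>.\<close>
      have id: "((cmod (w $ 1))\<^sup>2 + (cmod (w $ 2))\<^sup>2 / 4) * ((cmod a0)\<^sup>2 + (cmod s0)\<^sup>2 / 4)
          = (cmod (u w))\<^sup>2 + (cmod (w $ 1 * s0 / 2 - w $ 2 / 2 * a0))\<^sup>2"
      proof -
        have "complex_of_real (((cmod (w $ 1))\<^sup>2 + (cmod (w $ 2))\<^sup>2 / 4) * ((cmod a0)\<^sup>2 + (cmod s0)\<^sup>2 / 4))
          = of_real ((cmod (u w))\<^sup>2 + (cmod (w $ 1 * s0 / 2 - w $ 2 / 2 * a0))\<^sup>2)"
          unfolding of_real_mult of_real_add of_real_divide complex_norm_square u_def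
          by (simp add: field_simps)
        then show ?thesis by (simp only: of_real_eq_iff)
      qed
      have one: "(cmod a0)\<^sup>2 + (cmod s0)\<^sup>2 / 4 = 1" using b(4) by simp
      have le: "(cmod (u w))\<^sup>2 \<le> 1\<^sup>2"
        using id s zero_le_power2[of "cmod (w $ 1 * s0 / 2 - w $ 2 / 2 * a0)"]
        unfolding one one_power2 mult_1_right by linarith
      then have u1: "cmod (u w) \<le> 1" by (rule power2_le_imp_le) simp
      have "u w \<noteq> 1"
      proof
        assume u: "u w = 1"
        have "(cmod (w $ 1 * s0 / 2 - w $ 2 / 2 * a0))\<^sup>2 \<le> 0"
          using id s unfolding one u by simp
        then have e: "w $ 1 * s0 = w $ 2 * a0" by simp
        have one': "cnj a0 * a0 + cnj s0 * s0 / 4 = 1"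
        proof -
          have "complex_of_real ((cmod a0)\<^sup>2 + (cmod s0)\<^sup>2 / 4) = 1" unfolding one by simp
          then show ?thesis
            unfolding of_real_add of_real_divide complex_norm_square by (simp add: mult.commute)
        qed
        have "w $ 1 = w $ 1 * (cnj a0 * a0) + cnj s0 * (w $ 1 * s0) / 4"
          using arg_cong[OF one', of "\<lambda>x. w $ 1 * x"] by (simp add: algebra_simps)
        also have "\<dots> = u w * a0" unfolding e u_def by (simp add: algebra_simps)
        finally have w1: "w $ 1 = a0" using u by simp
        have "w $ 2 = cnj a0 * (w $ 2 * a0) + w $ 2 * (cnj s0 * s0) / 4"
          using arg_cong[OF one', of "\<lambda>x. w $ 2 * x"] by (simp add: algebra_simps)
        also have "\<dots> = u w * s0" unfolding e[symmetric] u_def by (simp add: algebra_simps)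
        finally have w2: "w $ 2 = s0" using u by simp
        show False using \<open>w \<noteq> w0\<close> w1 w2 wp by (auto simp: vec_eq_iff forall_3 a0_def s0_def p0_def)
      qed
      then show ?thesis using cmod_half_one_plus(2)[OF u1] by (simp add: h_def)
    qed
  qed
qed

section \<open>The maximum modulus property through analytic discs\<close>

lemma maximum_modulus_unit_disc:
  assumes "f holomorphic_on ball 0 1" "continuous_on (cball 0 1) f"
    and "\<And>z. cmod z = 1 \<Longrightarrow> cmod (f z) \<le> M" and "cmod z \<le> 1"
  shows "cmod (f z) \<le> M"
  by (rule maximum_modulus_frontier[of f "cball 0 1"]) (use assms in simp_all)

lemma Moebius_disc:
  assumes \<sigma>: "cmod \<sigma> < 1"
  obtains m where "m holomorphic_on ball 0 1" "continuous_on (cball 0 1) m" "m 0 = \<sigma>"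
    "\<And>z. cmod z < 1 \<Longrightarrow> cmod (m z) < 1" "\<And>z. cmod z = 1 \<Longrightarrow> cmod (m z) = 1"
proof -
  define m where "m z = (z + \<sigma>) / (1 + cnj \<sigma> * z)" for z
  have nz: "1 + cnj \<sigma> * z \<noteq> 0" if "cmod z \<le> 1" for z
    using cmod_Moebius_denominator[of "- \<sigma>" z] \<sigma> that by simp
  show thesis
  proof (rule that)
    show "m holomorphic_on ball 0 1" "continuous_on (cball 0 1) m"
      unfolding m_def using nz by (auto intro!: holomorphic_intros continuous_intros)
    show "m 0 = \<sigma>" by (simp add: m_def)
    show "cmod (m z) = 1" if "cmod z = 1" for z
    proof -
      have e: "cmod (1 + cnj \<sigma> * z) = cmod (z + \<sigma>)" using cmod_Moebius_circle[OF that, of "- \<sigma>"] by simp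
      show ?thesis unfolding m_def norm_divide e[symmetric] using nz[of z] that by simp
    qed
    fix z assume z: "cmod z < 1"
    have "complex_of_real ((cmod (1 + cnj \<sigma> * z))\<^sup>2 - (cmod (z + \<sigma>))\<^sup>2)
        = of_real ((1 - (cmod z)\<^sup>2) * (1 - (cmod \<sigma>)\<^sup>2))"
      unfolding of_real_mult of_real_diff complex_norm_square by (simp add: algebra_simps)
    then have "(cmod (1 + cnj \<sigma> * z))\<^sup>2 - (cmod (z + \<sigma>))\<^sup>2 = (1 - (cmod z)\<^sup>2) * (1 - (cmod \<sigma>)\<^sup>2)"
      by (simp only: of_real_eq_iff)
    moreover have "0 < (1 - (cmod z)\<^sup>2) * (1 - (cmod \<sigma>)\<^sup>2)"
      using z \<sigma> by (intro mult_pos_pos) (simp_all add: power_less_one_iff)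
    ultimately have "(cmod (z + \<sigma>))\<^sup>2 < (cmod (1 + cnj \<sigma> * z))\<^sup>2" by linarith
    then have "cmod (z + \<sigma>) < cmod (1 + cnj \<sigma> * z)" by (rule power2_less_imp_less) simp
    then show "cmod (m z) < 1" using nz[of z] z by (simp add: m_def norm_divide)
  qed
qed

text \<open>Replacing the two singular values by Moebius maps of the disc through them.\<close>

lemma contraction_disc:
  assumes A: "bounded_matrix r a b c d" and r: "0 \<le> r" "r < 1"
  obtains \<alpha> \<beta> \<gamma> \<delta> where
    "\<alpha> holomorphic_on ball 0 1" "\<beta> holomorphic_on ball 0 1"
    "\<gamma> holomorphic_on ball 0 1" "\<delta> holomorphic_on ball 0 1"
    "continuous_on (cball 0 1) \<alpha>" "continuous_on (cball 0 1) \<beta>"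
    "continuous_on (cball 0 1) \<gamma>" "continuous_on (cball 0 1) \<delta>"
    "\<alpha> 0 = a" "\<beta> 0 = b" "\<gamma> 0 = c" "\<delta> 0 = d"
    "\<And>z. cmod z < 1 \<Longrightarrow> \<exists>r\<in>{0..<1}. bounded_matrix r (\<alpha> z) (\<beta> z) (\<gamma> z) (\<delta> z)"
    "\<And>z. cmod z = 1 \<Longrightarrow> bounded_matrix 1 (\<alpha> z) (\<beta> z) (\<gamma> z) (\<delta> z)"
    "\<And>z. cmod z = 1 \<Longrightarrow> cmod (\<alpha> z * \<delta> z - \<beta> z * \<gamma> z) = 1"
proof -
  obtain x y \<xi> \<eta> u v where xy: "(cmod x)\<^sup>2 + (cmod y)\<^sup>2 = 1" and n: "(cmod \<xi>)\<^sup>2 + (cmod \<eta>)\<^sup>2 = 1"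
    and abcd: "a = u * x * cnj \<xi> + v * cnj y * \<eta>" "b = u * x * cnj \<eta> - v * cnj y * \<xi>"
    "c = u * y * cnj \<xi> - v * cnj x * \<eta>" "d = u * y * cnj \<eta> + v * cnj x * \<xi>"
    by (rule singular_value_form)
  have uv: "cmod u < 1" "cmod v < 1"
    using singular_value_form_norm(1)[OF xy n abcd] A r by auto
  obtain f where f: "f holomorphic_on ball 0 1" "continuous_on (cball 0 1) f" "f 0 = u"
    "\<And>z. cmod z < 1 \<Longrightarrow> cmod (f z) < 1" "\<And>z. cmod z = 1 \<Longrightarrow> cmod (f z) = 1"
    using Moebius_disc[OF uv(1)] by blast
  obtain g where g: "g holomorphic_on ball 0 1" "continuous_on (cball 0 1) g" "g 0 = v"
    "\<And>z. cmod z < 1 \<Longrightarrow> cmod (g z) < 1" "\<And>z. cmod z = 1 \<Longrightarrow> cmod (g z) = 1"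
    using Moebius_disc[OF uv(2)] by blast
  note form = singular_value_form_norm[OF xy n refl refl refl refl]
  show thesis
  proof (rule that[of "\<lambda>z. f z * x * cnj \<xi> + g z * cnj y * \<eta>" "\<lambda>z. f z * x * cnj \<eta> - g z * cnj y * \<xi>"
        "\<lambda>z. f z * y * cnj \<xi> - g z * cnj x * \<eta>" "\<lambda>z. f z * y * cnj \<eta> + g z * cnj x * \<xi>"])
    fix z :: complex
    show "\<exists>r\<in>{0..<1}. bounded_matrix r (f z * x * cnj \<xi> + g z * cnj y * \<eta>) (f z * x * cnj \<eta> - g z * cnj y * \<xi>)
        (f z * y * cnj \<xi> - g z * cnj x * \<eta>) (f z * y * cnj \<eta> + g z * cnj x * \<xi>)" if "cmod z < 1"
      unfolding form(1) using f(4)[OF that] g(4)[OF that]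
      by (intro bexI[of _ "max (cmod (f z)) (cmod (g z))"]) (auto simp: le_max_iff_disj)
    show "bounded_matrix 1 (f z * x * cnj \<xi> + g z * cnj y * \<eta>) (f z * x * cnj \<eta> - g z * cnj y * \<xi>)
        (f z * y * cnj \<xi> - g z * cnj x * \<eta>) (f z * y * cnj \<eta> + g z * cnj x * \<xi>)" if "cmod z = 1"
      unfolding form(1) using f(5)[OF that] g(5)[OF that] by simp
    show "cmod ((f z * x * cnj \<xi> + g z * cnj y * \<eta>) * (f z * y * cnj \<eta> + g z * cnj x * \<xi>)
        - (f z * x * cnj \<eta> - g z * cnj y * \<xi>) * (f z * y * cnj \<xi> - g z * cnj x * \<eta>)) = 1" if "cmod z = 1"
      unfolding form(2) using f(5)[OF that] g(5)[OF that] by (simp add: norm_mult)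
  qed (use f(1-3) g(1-3) abcd in \<open>auto intro!: holomorphic_intros continuous_intros\<close>)
qed

text \<open>Compactness yields a point \<open>z\<close> maximising \<open>cmod (f w)\<close> over
  \<open>Gamma_boundary\<close>. Every point of the domain is the centre of a matrix disc whose rim
  maps into that set, so the one-variable principle applies; continuity carries the bound to the
  closure.\<close>

lemma Gamma_boundary_max_modulus_set: "max_modulus_set sym_bidisc Gamma_boundary"
  unfolding max_modulus_set_def
proof (intro conjI allI impI)
  show "closed Gamma_boundary" by (rule closed_Gamma_boundary)
  show "Gamma_boundary \<subseteq> closure sym_bidisc" by (rule Gamma_boundary_subset)
  fix f assume "continuous_on (closure sym_bidisc) f \<and> holomorphic_on_vec f sym_bidisc"
  then have cont: "continuous_on (closure sym_bidisc) f" and hol: "holomorphic_on_vec f sym_bidisc" by auto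
  have "compact Gamma_boundary"
    using compact_closure_sym_bidisc closed_Gamma_boundary Gamma_boundary_subset
    by (metis compact_Int_closed inf.absorb_iff2)
  moreover have "vector [2, 1] \<in> Gamma_boundary" by (rule Gamma_boundaryI) simp_all
  then have "Gamma_boundary \<noteq> {}" by blast
  moreover have "continuous_on Gamma_boundary (\<lambda>w. cmod (f w))"
    using cont Gamma_boundary_subset by (intro continuous_intros) (rule continuous_on_subset)
  ultimately obtain z where z: "z \<in> Gamma_boundary" "\<And>w. w \<in> Gamma_boundary \<Longrightarrow> cmod (f w) \<le> cmod (f z)"
    using continuous_attains_sup[of Gamma_boundary "\<lambda>w. cmod (f w)"] by blast
  have *: "cmod (f w) \<le> cmod (f z)" if w_in: "w \<in> sym_bidisc" for w
  proof -
    obtain a b c d r where A: "bounded_matrix r a b c d" "0 \<le> r" "r < 1" and w: "w = vector [a + d, a * d - b * c]"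
      using w_in unfolding sym_bidisc_iff by (metis atLeastLessThan_iff)
    obtain \<alpha> \<beta> \<gamma> \<delta> where D:
      "\<alpha> holomorphic_on ball 0 1" "\<beta> holomorphic_on ball 0 1"
      "\<gamma> holomorphic_on ball 0 1" "\<delta> holomorphic_on ball 0 1"
      "continuous_on (cball 0 1) \<alpha>" "continuous_on (cball 0 1) \<beta>"
      "continuous_on (cball 0 1) \<gamma>" "continuous_on (cball 0 1) \<delta>"
      "\<alpha> 0 = a" "\<beta> 0 = b" "\<gamma> 0 = c" "\<delta> 0 = d"
      "\<And>z. cmod z < 1 \<Longrightarrow> \<exists>r\<in>{0..<1}. bounded_matrix r (\<alpha> z) (\<beta> z) (\<gamma> z) (\<delta> z)"
      "\<And>z. cmod z = 1 \<Longrightarrow> bounded_matrix 1 (\<alpha> z) (\<beta> z) (\<gamma> z) (\<delta> z)"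
      "\<And>z. cmod z = 1 \<Longrightarrow> cmod (\<alpha> z * \<delta> z - \<beta> z * \<gamma> z) = 1"
      using contraction_disc[OF A] by blast
    define \<phi> where "\<phi> z = (vector [\<alpha> z + \<delta> z, \<alpha> z * \<delta> z - \<beta> z * \<gamma> z] :: complex^2)" for z
    have bd: "\<phi> z \<in> Gamma_boundary" if "cmod z = 1" for z
      by (rule Gamma_boundaryI, unfold \<phi>_def vector_2)
        (rule contraction_boundary_values[OF D(14,15)[OF that]] D(15)[OF that])+
    have int: "\<phi> z \<in> sym_bidisc" if "cmod z < 1" for z
      using D(13)[OF that] unfolding sym_bidisc_iff \<phi>_def by blast
    have "\<phi> z \<in> closure sym_bidisc" if "cmod z \<le> 1" for z
      using bd[of z] int[of z] that Gamma_boundary_subset closure_subset by (cases "cmod z = 1") force+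
    then have c: "continuous_on (cball 0 1) (\<lambda>z. f (\<phi> z))"
      by (intro continuous_on_compose2[OF cont]) (auto simp: \<phi>_def intro!: continuous_intros D)
    have "(\<lambda>z. \<phi> z $ i) holomorphic_on ball 0 1" for i
      using exhaust_2[of i] by (auto simp: \<phi>_def intro!: holomorphic_intros D)
    then have h: "(\<lambda>z. f (\<phi> z)) holomorphic_on ball 0 1"
      using int by (intro holomorphic_on_vec_compose[OF hol]) auto
    have "cmod (f (\<phi> 0)) \<le> cmod (f z)"
      by (rule maximum_modulus_unit_disc[OF h c]) (use bd z in auto)
    then show ?thesis by (simp add: \<phi>_def w D)
  qed
  show "\<exists>z\<in>Gamma_boundary. \<forall>w\<in>closure sym_bidisc. cmod (f w) \<le> cmod (f z)"
    using continuous_on_closure_norm_le[OF cont] * z(1) by blast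
qed

text \<open>Over a point of the distinguished boundary of the symmetrized bidisc, the fibre of the closed
  pentablock is a disc. It lies in the topological boundary, so the maximum principle is applied to
  the slices \<open>(ra, rs, r\<^sup>2p)\<close> and then \<open>r \<rightarrow> 1\<close>.\<close>

lemma pentablock_fibre_bound:
  assumes cont: "continuous_on (closure pentablock) f" and hol: "holomorphic_on_vec f pentablock"
    and M: "\<And>w. w \<in> penta_boundary \<Longrightarrow> cmod (f w) \<le> M"
    and sp: "cmod s \<le> 2" "s = cnj s * p" "cmod p = 1" and a: "(cmod a)\<^sup>2 \<le> 1 - (cmod s)\<^sup>2 / 4"
  shows "cmod (f (vector [a, s, p])) \<le> M"
proof -
  define R where "R = sqrt (1 - (cmod s)\<^sup>2 / 4)"
  have "(cmod s)\<^sup>2 \<le> 2\<^sup>2" by (rule power_mono[OF sp(1)]) simp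
  then have R: "0 \<le> R" "R\<^sup>2 = 1 - (cmod s)\<^sup>2 / 4" "R \<le> 1" by (simp_all add: R_def)
  have "cmod a \<le> R" using a R by (intro power2_le_imp_le[OF _ R(1)]) simp
  then obtain k0 where k0: "cmod k0 \<le> 1" "a = k0 * of_real R"
  proof (cases "R = 0")
    case True
    then show thesis using that[of 0] \<open>cmod a \<le> R\<close> by simp
  next
    case False
    then show thesis using that[of "a / of_real R"] \<open>cmod a \<le> R\<close> R(1) by (simp add: norm_divide)
  qed
  define Q where "Q r k = (vector [of_real r * (k * of_real R), of_real r * s, of_real r ^ 2 * p] :: complex^3)"
    for r k
  have R2: "(cmod (of_real R))\<^sup>2 = 1 - (cmod s)\<^sup>2 / 4" using R by simp
  have Q1: "Q 1 k \<in> penta_boundary" if "cmod k = 1" for k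
    by (rule penta_boundaryI; unfold Q_def vector_3 of_real_1 one_power2 mult_1)
      (fact sp, fact sp, fact sp, use that R2 in \<open>simp add: norm_mult\<close>)
  \<comment> \<open>The unitary matrix over \<open>(s, p)\<close> with corner \<open>R\<close>
    realises the rim of the fibre; shrinking its corner by \<open>k\<close> fills the disc without
    changing trace or determinant.\<close>
  have Qmat: "\<exists>a' b' d'. bounded_matrix 1 a' b' (k * of_real R) d' \<and> s = a' + d' \<and>
      p = a' * d' - b' * (k * of_real R)" if k: "cmod k \<le> 1" for k
  proof -
    note m = penta_boundary_matrix[OF sp(3,2) R2]
    obtain a' b' d' where "bounded_matrix 1 a' b' (k * of_real R) d'" "a' + d' = s / 2 + s / 2"
      "a' * d' - b' * (k * of_real R) = s / 2 * (s / 2) - (- p * cnj (of_real R)) * of_real R"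
      using shrink_corner[OF m(1) k] by blast
    moreover from this have "s = a' + d'" "p = a' * d' - b' * (k * of_real R)" unfolding m(2) by simp_all
    ultimately show ?thesis by blast
  qed
  have Qin: "Q r k \<in> pentablock" if r: "0 \<le> r" "r < 1" and k: "cmod k \<le> 1" for r k
  proof -
    obtain a' b' d' where *: "bounded_matrix 1 a' b' (k * of_real R) d'" "s = a' + d'"
      "p = a' * d' - b' * (k * of_real R)"
      using Qmat[OF k] by blast
    have "of_real r * s = of_real r * a' + of_real r * d'"
      "of_real r ^ 2 * p = (of_real r * a') * (of_real r * d') - (of_real r * b') * (of_real r * (k * of_real R))"
      unfolding *(2,3) by (simp_all add: algebra_simps power2_eq_square)
    then have "Q r k = vector [of_real r * (k * of_real R), of_real r * a' + of_real r * d',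
       (of_real r * a') * (of_real r * d') - (of_real r * b') * (of_real r * (k * of_real R))]"
      unfolding Q_def by (simp only:)
    moreover have "bounded_matrix r (of_real r * a') (of_real r * b') (of_real r * (k * of_real R)) (of_real r * d')"
      by (rule bounded_matrix_scale[OF *(1)])
    moreover have "r \<in> {0..<1}" using r by simp
    ultimately show ?thesis unfolding pentablock_iff by blast
  qed
  have Qcl: "Q 1 k \<in> closure pentablock" if "cmod k \<le> 1" for k
  proof -
    have "Q 1 k = vector [k * of_real R, s, p]" by (simp add: Q_def)
    then show ?thesis using Qmat[OF that] unfolding closure_pentablock_iff by metis
  qed
  \<comment> \<open>The constant is \<open>1 + 2 + 2\<close>, one term per coordinate, from
    \<open>R \<le> 1\<close>, \<open>cmod s \<le> 2\<close> and
    \<open>1 - r^2 \<le> 2 * (1 - r)\<close>.\<close>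
  have dist: "dist (Q r k) (Q 1 k) \<le> 5 * (1 - r)" if r: "0 \<le> r" "r < 1" and k: "cmod k \<le> 1" for r k
  proof -
    have "dist (Q r k) (Q 1 k) \<le> (\<Sum>i\<in>UNIV. cmod ((Q r k - Q 1 k) $ i))"
      unfolding dist_norm norm_vec_def by (intro L2_set_le_sum) simp
    also have "\<dots> = cmod ((of_real r - 1) * (k * of_real R)) + cmod ((of_real r - 1) * s) + cmod ((of_real r ^ 2 - 1) * p)"
      by (simp add: sum_3 Q_def algebra_simps)
    also have "\<dots> = (1 - r) * (cmod k * R) + (1 - r) * cmod s + (1 - r\<^sup>2)"
    proof -
      have "cmod (of_real r - 1) = \<bar>r - 1\<bar>" "cmod (of_real r ^ 2 - 1) = \<bar>r\<^sup>2 - 1\<bar>"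
        by (metis norm_of_real of_real_1 of_real_diff of_real_power)+
      moreover have "r\<^sup>2 \<le> 1" using r by (simp add: power_le_one)
      ultimately show ?thesis using r R(1) sp(3) by (simp add: norm_mult)
    qed
    also have "\<dots> \<le> (1 - r) * 1 + (1 - r) * 2 + (1 - r) * 2"
    proof (intro add_mono mult_left_mono)
      have "cmod k * R \<le> 1 * 1" using k R by (intro mult_mono) auto
      then show "cmod k * R \<le> 1" by simp
      have "(1 - r) * (1 + r) \<le> (1 - r) * 2" using r by (intro mult_left_mono) auto
      then show "1 - r\<^sup>2 \<le> (1 - r) * 2" by (simp add: algebra_simps power2_eq_square)
    qed (use r sp(1) in auto)
    finally show ?thesis by simp
  qed
  have "cmod (f (Q 1 k0)) \<le> M + e" if e: "e > 0" for e
  proof -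
    have "uniformly_continuous_on (closure pentablock) f"
      by (rule compact_uniformly_continuous[OF cont compact_closure_pentablock])
    then obtain d where d: "d > 0" "\<And>w w'. w \<in> closure pentablock \<Longrightarrow> w' \<in> closure pentablock \<Longrightarrow>
        dist w' w < d \<Longrightarrow> dist (f w') (f w) < e / 2"
      using e unfolding uniformly_continuous_on_def by (metis half_gt_zero)
    \<comment> \<open>Here \<open>5 * (1 - r) \<le> d / 2 < d\<close>, and \<open>max\<close> keeps
      \<open>r\<close> non-negative. Half of \<open>e\<close> is spent on replacing
      \<open>Q r\<close> by \<open>Q 1\<close> on the rim, the other half on returning to
      \<open>Q 1\<close> at \<open>k0\<close>.\<close>
    define r where "r = max 0 (1 - d / 10)"
    have r: "0 \<le> r" "r < 1" "5 * (1 - r) < d" using d(1) by (auto simp: r_def max_def)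
    have close: "cmod (f (Q r k) - f (Q 1 k)) < e / 2" if k: "cmod k \<le> 1" for k
      using d(2)[OF Qcl[OF k] subsetD[OF closure_subset Qin[OF r(1,2) k]]] dist[OF r(1,2) k] r(3)
      by (simp add: dist_norm)
    have "Q r k \<in> closure pentablock" if "cmod k \<le> 1" for k
      using subsetD[OF closure_subset Qin[OF r(1,2) that]] .
    then have c: "continuous_on (cball 0 1) (\<lambda>k. f (Q r k))"
      by (intro continuous_on_compose2[OF cont]) (auto simp: Q_def intro!: continuous_intros)
    have "(\<lambda>k. Q r k $ i) holomorphic_on ball 0 1" for i
      using exhaust_3[of i] by (auto simp: Q_def intro!: holomorphic_intros)
    then have h: "(\<lambda>k. f (Q r k)) holomorphic_on ball 0 1"
      using Qin[OF r(1,2)] by (intro holomorphic_on_vec_compose[OF hol]) auto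
    have "cmod (f (Q r k0)) \<le> M + e / 2"
    proof (rule maximum_modulus_unit_disc[OF h c _ k0(1)])
      fix k :: complex assume k: "cmod k = 1"
      then show "cmod (f (Q r k)) \<le> M + e / 2"
        using close[of k] M[OF Q1[OF k]] norm_triangle_ineq2[of "f (Q r k)" "f (Q 1 k)"] by simp
    qed
    then show ?thesis
      using close[OF k0(1)] norm_triangle_ineq3[of "f (Q r k0)" "f (Q 1 k0)"] by simp
  qed
  then have "cmod (f (Q 1 k0)) \<le> M" by (rule field_le_epsilon)
  then show ?thesis by (simp add: Q_def k0(2))
qed

text \<open>The rim of a matrix disc lies over \<open>Gamma_boundary\<close> but possibly inside the
  fibres, so the bound there is taken from \<open>pentablock_fibre_bound\<close> before the maximum
  principle is applied to the disc.\<close>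

lemma penta_boundary_max_modulus_set: "max_modulus_set pentablock penta_boundary"
  unfolding max_modulus_set_def
proof (intro conjI allI impI)
  show "closed penta_boundary" by (rule closed_penta_boundary)
  show "penta_boundary \<subseteq> closure pentablock" by (rule penta_boundary_subset)
  fix f assume "continuous_on (closure pentablock) f \<and> holomorphic_on_vec f pentablock"
  then have cont: "continuous_on (closure pentablock) f" and hol: "holomorphic_on_vec f pentablock" by auto
  have "compact penta_boundary"
    using compact_closure_pentablock closed_penta_boundary penta_boundary_subset
    by (metis compact_Int_closed inf.absorb_iff2)
  moreover have "vector [0, 2, 1] \<in> penta_boundary" by (rule penta_boundaryI) simp_all
  then have "penta_boundary \<noteq> {}" by blast
  moreover have "continuous_on penta_boundary (\<lambda>w. cmod (f w))"
    using cont penta_boundary_subset by (intro continuous_intros) (rule continuous_on_subset)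
  ultimately obtain z where z: "z \<in> penta_boundary" "\<And>w. w \<in> penta_boundary \<Longrightarrow> cmod (f w) \<le> cmod (f z)"
    using continuous_attains_sup[of penta_boundary "\<lambda>w. cmod (f w)"] by blast
  have *: "cmod (f w) \<le> cmod (f z)" if w_in: "w \<in> pentablock" for w
  proof -
    obtain a b c d r where A: "bounded_matrix r a b c d" "0 \<le> r" "r < 1" and w: "w = vector [c, a + d, a * d - b * c]"
      using w_in unfolding pentablock_iff by (metis atLeastLessThan_iff)
    obtain \<alpha> \<beta> \<gamma> \<delta> where D:
      "\<alpha> holomorphic_on ball 0 1" "\<beta> holomorphic_on ball 0 1"
      "\<gamma> holomorphic_on ball 0 1" "\<delta> holomorphic_on ball 0 1"
      "continuous_on (cball 0 1) \<alpha>" "continuous_on (cball 0 1) \<beta>"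
      "continuous_on (cball 0 1) \<gamma>" "continuous_on (cball 0 1) \<delta>"
      "\<alpha> 0 = a" "\<beta> 0 = b" "\<gamma> 0 = c" "\<delta> 0 = d"
      "\<And>z. cmod z < 1 \<Longrightarrow> \<exists>r\<in>{0..<1}. bounded_matrix r (\<alpha> z) (\<beta> z) (\<gamma> z) (\<delta> z)"
      "\<And>z. cmod z = 1 \<Longrightarrow> bounded_matrix 1 (\<alpha> z) (\<beta> z) (\<gamma> z) (\<delta> z)"
      "\<And>z. cmod z = 1 \<Longrightarrow> cmod (\<alpha> z * \<delta> z - \<beta> z * \<gamma> z) = 1"
      using contraction_disc[OF A] by blast
    define \<phi> where "\<phi> z = (vector [\<gamma> z, \<alpha> z + \<delta> z, \<alpha> z * \<delta> z - \<beta> z * \<gamma> z] :: complex^3)" for z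
    have bd: "cmod (f (\<phi> \<zeta>)) \<le> cmod (f z)" if "cmod \<zeta> = 1" for \<zeta>
    proof -
      note bv = contraction_boundary_values[OF D(14,15)[OF that]]
      show ?thesis unfolding \<phi>_def
        by (rule pentablock_fibre_bound[OF cont hol z(2) bv(1,2) D(15)[OF that] bv(3)])
    qed
    have "\<phi> z \<in> closure pentablock" if "cmod z \<le> 1" for z
    proof -
      have "bounded_matrix 1 (\<alpha> z) (\<beta> z) (\<gamma> z) (\<delta> z)"
        using that D(13)[of z] D(14)[of z] bounded_matrix_mono[of _ _ _ _ _ 1] by (cases "cmod z = 1") force+
      then show ?thesis unfolding closure_pentablock_iff \<phi>_def by blast
    qed
    then have c: "continuous_on (cball 0 1) (\<lambda>z. f (\<phi> z))"
      by (intro continuous_on_compose2[OF cont]) (auto simp: \<phi>_def intro!: continuous_intros D)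
    have int: "\<phi> z \<in> pentablock" if "cmod z < 1" for z
      using D(13)[OF that] unfolding pentablock_iff \<phi>_def by blast
    have "(\<lambda>z. \<phi> z $ i) holomorphic_on ball 0 1" for i
      using exhaust_3[of i] by (auto simp: \<phi>_def intro!: holomorphic_intros D)
    then have h: "(\<lambda>z. f (\<phi> z)) holomorphic_on ball 0 1"
      using int by (intro holomorphic_on_vec_compose[OF hol]) auto
    have "cmod (f (\<phi> 0)) \<le> cmod (f z)"
      by (rule maximum_modulus_unit_disc[OF h c]) (use bd in auto)
    then show ?thesis by (simp add: \<phi>_def w D)
  qed
  show "\<exists>z\<in>penta_boundary. \<forall>w\<in>closure pentablock. cmod (f w) \<le> cmod (f z)"
    using continuous_on_closure_norm_le[OF cont] * z(1) by blast
qed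

lemma distinguished_boundary_sym_bidisc: "distinguished_boundary sym_bidisc = Gamma_boundary"
  by (rule distinguished_boundaryI[OF Gamma_boundary_max_modulus_set Gamma_boundary_subset_max_modulus_set])

lemma distinguished_boundary_pentablock: "distinguished_boundary pentablock = penta_boundary"
  by (rule distinguished_boundaryI[OF penta_boundary_max_modulus_set penta_boundary_subset_max_modulus_set])

section \<open>Rational inner functions\<close>

text \<open>With no degree bound available yet, the reversal is taken at order
  \<open>m = max n (degree f)\<close>. It equals \<open>z^(m - n) * f\<close> and has degree at most
  \<open>m\<close>, which leaves at most \<open>n\<close> for \<open>f\<close>.\<close>

lemma self_conjugate_poly:
  assumes "\<And>z. cmod z = 1 \<Longrightarrow> poly f z = z ^ n * cnj (poly f z)"
  shows "degree f \<le> n" "conj_reverse n f = f"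
proof -
  define m where "m = max n (degree f)"
  have "monom 1 (m - n) * f = conj_reverse m f"
  proof (rule poly_eqI_circle)
    fix z :: complex assume z: "cmod z = 1"
    have "poly (monom 1 (m - n) * f) z = z ^ (m - n) * (z ^ n * cnj (poly f z))"
      using assms[OF z] by (simp add: poly_monom)
    also have "\<dots> = z ^ m * cnj (poly f z)"
      unfolding mult.assoc[symmetric] power_add[symmetric] by (simp add: m_def)
    finally show "poly (monom 1 (m - n) * f) z = poly (conj_reverse m f) z"
      using z by (simp add: poly_conj_reverse_circle m_def)
  qed
  then have "degree (monom 1 (m - n) * f) \<le> m" using degree_conj_reverse_le by simp
  then show d: "degree f \<le> n"
    by (cases "f = 0") (auto simp: degree_mult_eq degree_monom_eq m_def)
  show "conj_reverse n f = f"
    by (rule poly_eqI_circle) (metis assms d poly_conj_reverse_circle)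
qed

text \<open>Without zeros at the origin, \<open>\<bar>M\<bar>\<^sup>2\<close> has degree exactly \<open>degree M\<close> as a trigonometric
  polynomial on the circle.\<close>

lemma degree_le_trig_degree:
  assumes M0: "poly M 0 \<noteq> 0" and T: "degree T \<le> 2 * n"
    and circle: "\<And>z. cmod z = 1 \<Longrightarrow> poly T z = z ^ n * of_real ((cmod (poly M z))\<^sup>2)"
  shows "degree M \<le> n"
proof -
  define m where "m = max n (degree M)"
  have dm: "degree M \<le> m" by (simp add: m_def)
  have "M * conj_reverse m M = monom 1 (m - n) * T"
  proof (rule poly_eqI_circle)
    fix z :: complex assume z: "cmod z = 1"
    have "poly (monom 1 (m - n) * T) z = z ^ (m - n) * z ^ n * of_real ((cmod (poly M z))\<^sup>2)"
      by (simp add: poly_monom circle[OF z])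
    also have "\<dots> = z ^ m * of_real ((cmod (poly M z))\<^sup>2)"
      unfolding power_add[symmetric] by (simp add: m_def)
    finally show "poly (M * conj_reverse m M) z = poly (monom 1 (m - n) * T) z"
      using mult_conj_reverse_circle[OF dm z] by (simp only:)
  qed
  moreover have "M \<noteq> 0" "conj_reverse m M \<noteq> 0"
    using M0 by (auto simp: conj_reverse_eq_0_iff m_def)
  \<comment> \<open>Since \<open>M\<close> does not vanish at the origin, its reversal has full
    degree \<open>m\<close>; comparison with \<open>(m - n) + 2 * n\<close> gives the bound.\<close>
  then have "degree (M * conj_reverse m M) = degree M + m"
    using degree_conj_reverse[OF M0] by (simp add: degree_mult_eq)
  ultimately have "degree M + m \<le> (m - n) + 2 * n"
    using degree_mult_le[of "monom 1 (m - n)" T] T degree_monom_le[of "1::complex" "m - n"] by simp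
  then show ?thesis by (simp add: m_def)
qed

text \<open>The trigonometric polynomial \<open>|D|^2 - |N2|^2 / 4\<close>, multiplied by
  \<open>z ^ n\<close> to become an honest polynomial.\<close>

definition boundary_gap :: "nat \<Rightarrow> complex poly \<Rightarrow> complex poly \<Rightarrow> complex poly" where
  "boundary_gap n N2 D = D * conj_reverse n D - smult (1/4) (N2 * conj_reverse n N2)"

lemma boundary_gap_circle:
  assumes "degree D \<le> n" "degree N2 \<le> n" "cmod z = 1"
  shows "poly (boundary_gap n N2 D) z
    = z ^ n * of_real ((cmod (poly D z))\<^sup>2 - 1/4 * (cmod (poly N2 z))\<^sup>2)"
  unfolding boundary_gap_def poly_diff poly_smult mult_conj_reverse_circle[OF assms(1,3)]
    mult_conj_reverse_circle[OF assms(2,3)]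
  by (simp add: algebra_simps)

lemma degree_boundary_gap:
  assumes "degree D \<le> n" "degree N2 \<le> n"
  shows "degree (boundary_gap n N2 D) \<le> 2 * n"
proof -
  have "degree (p * conj_reverse n p) \<le> 2 * n" if "degree p \<le> n" for p
    using degree_mult_le[of p "conj_reverse n p"] that degree_conj_reverse_le[of n p] by linarith
  then show ?thesis
    unfolding boundary_gap_def using assms by (intro degree_diff_le) (auto intro: order_trans[OF degree_smult_le])
qed

text \<open>Cleared of denominators, \<open>s = cnj s * p\<close> becomes
  \<open>N2 = z ^ n * cnj N2\<close> on the circle; the degree bound and the self-reversal of
  \<open>N2\<close> both come from this.\<close>

lemma Gamma_inner_quotientD:
  assumes G: "Gamma_inner_quotient n N2 D"
  shows "degree D \<le> n" "\<And>z. cmod z \<le> 1 \<Longrightarrow> poly D z \<noteq> 0" "degree N2 \<le> n" "conj_reverse n N2 = N2"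
    "\<And>z. cmod z = 1 \<Longrightarrow> vector [poly N2 z / poly D z, poly (conj_reverse n D) z / poly D z] \<in> Gamma_boundary"
proof -
  show D: "degree D \<le> n" and nz: "\<And>z. cmod z \<le> 1 \<Longrightarrow> poly D z \<noteq> 0"
    and b: "\<And>z. cmod z = 1 \<Longrightarrow> vector [poly N2 z / poly D z, poly (conj_reverse n D) z / poly D z] \<in> Gamma_boundary"
    using G unfolding Gamma_inner_quotient_def rational_Gamma_inner_def distinguished_boundary_sym_bidisc by auto
  have "poly N2 z = z ^ n * cnj (poly N2 z)" if z: "cmod z = 1" for z
  proof -
    have "poly N2 z / poly D z = cnj (poly N2 z / poly D z) * (z ^ n * cnj (poly D z) / poly D z)"
      using Gamma_boundaryD(2)[OF b[OF z]] unfolding vector_2 poly_conj_reverse_circle[OF D z] .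
    then show ?thesis using nz[of z] z by (simp add: field_simps)
  qed
  then show "degree N2 \<le> n" "conj_reverse n N2 = N2"
    using self_conjugate_poly[of N2 n] by blast+
qed

text \<open>The absence of zeros in the closed disc makes the fraction reduced, and
  \<open>poly D 0 \<noteq> 0\<close> gives the numerator degree exactly \<open>n\<close> even when
  \<open>degree D < n\<close>.\<close>

lemma rat_degree_conj_reverse_quotient:
  assumes D: "degree D \<le> n" and nz: "\<And>z. cmod z \<le> 1 \<Longrightarrow> poly D z \<noteq> 0"
  shows "rat_degree (\<lambda>z. poly (conj_reverse n D) z / poly D z) = n"
proof -
  have "coprime D (conj_reverse n D)" using nz D by (intro coprime_conj_reverse) auto
  then have "lowest_terms (\<lambda>z. poly (conj_reverse n D) z / poly D z) (conj_reverse n D) D"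
    using nz by (simp add: lowest_terms_def coprime_commute)
  from rat_degree_eq[OF this] show ?thesis
    using degree_conj_reverse[of D n] nz[of 0] D by simp
qed

text \<open>The maximum principle for operator norms, via the scalar functions \<open>\<langle>A(z)\<xi>, A(z\<^sub>0)\<xi>\<rangle>\<close>.\<close>

lemma bounded_matrix_maximum_principle:
  assumes hol: "\<alpha> holomorphic_on ball 0 1" "\<beta> holomorphic_on ball 0 1"
    "\<gamma> holomorphic_on ball 0 1" "\<delta> holomorphic_on ball 0 1"
    and cont: "continuous_on (cball 0 1) \<alpha>" "continuous_on (cball 0 1) \<beta>"
    "continuous_on (cball 0 1) \<gamma>" "continuous_on (cball 0 1) \<delta>"
    and circle: "\<And>z. cmod z = 1 \<Longrightarrow> bounded_matrix 1 (\<alpha> z) (\<beta> z) (\<gamma> z) (\<delta> z)"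
    and z0: "cmod z0 \<le> 1"
  shows "bounded_matrix 1 (\<alpha> z0) (\<beta> z0) (\<gamma> z0) (\<delta> z0)"
  unfolding bounded_matrix_def
proof (intro allI)
  fix x y
  define v1 where "v1 = \<alpha> z0 * x + \<beta> z0 * y"
  define v2 where "v2 = \<gamma> z0 * x + \<delta> z0 * y"
  define V where "V = sqrt ((cmod v1)\<^sup>2 + (cmod v2)\<^sup>2)"
  define X where "X = sqrt ((cmod x)\<^sup>2 + (cmod y)\<^sup>2)"
  define \<phi> where "\<phi> z = cnj v1 * (\<alpha> z * x + \<beta> z * y) + cnj v2 * (\<gamma> z * x + \<delta> z * y)" for z
  have V2: "V\<^sup>2 = (cmod v1)\<^sup>2 + (cmod v2)\<^sup>2" and X2: "X\<^sup>2 = (cmod x)\<^sup>2 + (cmod y)\<^sup>2" and VX: "0 \<le> V" "0 \<le> X"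
    by (simp_all add: V_def X_def)
  have "cmod (\<phi> z0) \<le> V * X"
  proof (rule maximum_modulus_unit_disc[OF _ _ _ z0])
    show "\<phi> holomorphic_on ball 0 1" "continuous_on (cball 0 1) \<phi>"
      unfolding \<phi>_def using hol cont by (auto intro!: holomorphic_intros continuous_intros)
    fix z :: complex assume z: "cmod z = 1"
    let ?p = "\<alpha> z * x + \<beta> z * y" and ?q = "\<gamma> z * x + \<delta> z * y"
    have "complex_of_real (((cmod v1)\<^sup>2 + (cmod v2)\<^sup>2) * ((cmod ?p)\<^sup>2 + (cmod ?q)\<^sup>2))
        = of_real ((cmod (\<phi> z))\<^sup>2 + (cmod (v1 * ?q - v2 * ?p))\<^sup>2)"
      unfolding of_real_mult of_real_add complex_norm_square \<phi>_def by (simp add: algebra_simps)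
    then have "V\<^sup>2 * ((cmod ?p)\<^sup>2 + (cmod ?q)\<^sup>2) = (cmod (\<phi> z))\<^sup>2 + (cmod (v1 * ?q - v2 * ?p))\<^sup>2"
      unfolding V2 by (simp only: of_real_eq_iff)
    then have "(cmod (\<phi> z))\<^sup>2 \<le> V\<^sup>2 * ((cmod ?p)\<^sup>2 + (cmod ?q)\<^sup>2)"
      using zero_le_power2[of "cmod (v1 * ?q - v2 * ?p)"] by linarith
    also have "\<dots> \<le> V\<^sup>2 * X\<^sup>2"
      using circle[OF z] unfolding bounded_matrix_def X2 by (intro mult_left_mono) auto
    finally have "(cmod (\<phi> z))\<^sup>2 \<le> (V * X)\<^sup>2" by (simp add: power_mult_distrib)
    then show "cmod (\<phi> z) \<le> V * X" by (rule power2_le_imp_le) (use VX in simp)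
  qed
  moreover have "\<phi> z0 = of_real (V\<^sup>2)"
    unfolding V2 of_real_add complex_norm_square \<phi>_def v1_def[symmetric] v2_def[symmetric]
    by (simp add: mult.commute)
  ultimately have "V\<^sup>2 \<le> V * X" by (simp only: norm_of_real abs_power2)
  then have "V \<le> X" using VX by (cases "V = 0") (auto simp: power2_eq_square)
  then have "V\<^sup>2 \<le> X\<^sup>2" using VX by (intro power_mono) auto
  then show "(cmod (\<alpha> z0 * x + \<beta> z0 * y))\<^sup>2 + (cmod (\<gamma> z0 * x + \<delta> z0 * y))\<^sup>2 \<le> 1\<^sup>2 * ((cmod x)\<^sup>2 + (cmod y)\<^sup>2)"
    unfolding V2 X2 v1_def v2_def by simp
qed

section \<open>The converse: quotients satisfying the modulus identity are inner\<close>

lemma penta_boundary_quotientI: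
  assumes "vector [s, p] \<in> Gamma_boundary" "(cmod a)\<^sup>2 = 1 - (cmod s)\<^sup>2 / 4"
  shows "vector [a, s, p] \<in> penta_boundary"
  by (rule penta_boundaryI; unfold vector_3)
    (rule Gamma_boundaryD[OF assms(1), unfolded vector_2] assms(2))+

lemma modulus_identity_quotient:
  assumes "modulus_identity N1 N2 D" "cmod z = 1" "poly D z \<noteq> 0"
  shows "(cmod (poly N1 z / poly D z))\<^sup>2 = 1 - (cmod (poly N2 z / poly D z))\<^sup>2 / 4"
  using assms by (simp add: modulus_identity_def norm_divide power_divide field_simps)

text \<open>The matrix \<open>[[s/2, - M\<^sup>\<sim>/D], [M/D, s/2]]\<close> is unitary on the circle and has determinant \<open>p\<close>.
  A factor \<open>z\<^sup>k\<close> split off \<open>N\<^sub>1\<close> is restored by shrinking the corner pointwise.\<close>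

lemma quotient_in_closure_pentablock:
  assumes G: "Gamma_inner_quotient n N2 D" and I: "modulus_identity N1 N2 D" and z0: "cmod z0 \<le> 1"
  shows "vector [poly N1 z0 / poly D z0, poly N2 z0 / poly D z0, poly (conj_reverse n D) z0 / poly D z0]
    \<in> closure pentablock"
proof -
  note Q = Gamma_inner_quotientD[OF G]
  \<comment> \<open>No degree bound on \<open>N1\<close> is given. The factor \<open>z ^ k\<close>
    has modulus one on the circle, so \<open>M\<close> satisfies the same identity, and
    \<open>poly M 0 \<noteq> 0\<close> then yields \<open>degree M \<le> n\<close>, which makes its
    reversal meaningful.\<close>
  obtain k M where N1: "\<And>z. poly N1 z = z ^ k * poly M z" and M: "M = 0 \<or> poly M 0 \<noteq> 0"
  proof (cases "N1 = 0")
    case True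
    then show thesis using that[of 0 0] by simp
  next
    case False
    then obtain M where M: "N1 = [:- 0, 1:] ^ order 0 N1 * M" "\<not> [:- 0, 1:] dvd M"
      using order_decomp by blast
    have "poly ([:- 0, 1:] ^ order 0 N1 * M) z = z ^ order 0 N1 * poly M z" for z by simp
    then have "poly N1 z = z ^ order 0 N1 * poly M z" for z unfolding M(1)[symmetric] .
    moreover have "poly M 0 \<noteq> 0" using M(2) by (simp only: poly_eq_0_iff_dvd not_False_eq_True)
    ultimately show thesis using that by blast
  qed
  have circle: "(cmod (poly M z))\<^sup>2 = (cmod (poly D z))\<^sup>2 - 1/4 * (cmod (poly N2 z))\<^sup>2" if "cmod z = 1" for z
    using I that by (simp add: modulus_identity_def N1 norm_mult norm_power)
  have dM: "degree M \<le> n"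
  proof (cases "M = 0")
    case False
    then show ?thesis
      using M degree_boundary_gap[OF Q(1,3)] boundary_gap_circle[OF Q(1,3)] circle
      by (intro degree_le_trig_degree[of M "boundary_gap n N2 D"]) simp_all
  qed simp
  have det: "boundary_gap n N2 D = M * conj_reverse n M"
    by (rule poly_eqI_circle) (simp only: boundary_gap_circle[OF Q(1,3)] mult_conj_reverse_circle[OF dM] circle)
  let ?s = "\<lambda>z. poly N2 z / poly D z" and ?p = "\<lambda>z. poly (conj_reverse n D) z / poly D z"
  let ?b = "\<lambda>z. - poly (conj_reverse n M) z / poly D z" and ?c = "\<lambda>z. poly M z / poly D z"
  have B: "bounded_matrix 1 (?s z0 / 2) (?b z0) (?c z0) (?s z0 / 2)"
  proof (rule bounded_matrix_maximum_principle[OF _ _ _ _ _ _ _ _ _ z0])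
    fix z :: complex assume z: "cmod z = 1"
    have D0: "poly D z \<noteq> 0" using Q(2) z by simp
    have "modulus_identity M N2 D" using circle by (simp add: modulus_identity_def)
    from modulus_identity_quotient[OF this z D0]
    have c2: "(cmod (?c z))\<^sup>2 = 1 - (cmod (?s z))\<^sup>2 / 4" .
    have "?b z = - ?p z * cnj (?c z)"
      unfolding poly_conj_reverse_circle[OF Q(1) z] poly_conj_reverse_circle[OF dM z]
      using D0 by (simp add: field_simps)
    then show "bounded_matrix 1 (?s z / 2) (?b z) (?c z) (?s z / 2)"
      using penta_boundary_matrix(1)[OF Gamma_boundaryD(3,2)[OF Q(5)[OF z], unfolded vector_2] c2] by (simp only:)
  qed (use Q(2) in \<open>auto intro!: holomorphic_intros continuous_intros\<close>)
  \<comment> \<open>As \<open>N2\<close> is its own reversal, the gap identity is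
    \<open>D * D~ - N2^2 / 4 = M * M~\<close>, with \<open>~\<close> for reversal at order
    \<open>n\<close>; division by \<open>D^2\<close> turns it into the determinant formula at every
    point of the closed disc.\<close>
  have "(?s z0 / 2) * (?s z0 / 2) - ?b z0 * ?c z0 = ?p z0"
  proof -
    have "poly (boundary_gap n N2 D) z0 = poly (M * conj_reverse n M) z0" unfolding det ..
    then have "poly M z0 * poly (conj_reverse n M) z0
        = poly D z0 * poly (conj_reverse n D) z0 - (poly N2 z0)\<^sup>2 / 4"
      by (simp add: boundary_gap_def Q(4) power2_eq_square)
    then show ?thesis using Q(2)[OF z0] by (simp add: field_simps power2_eq_square)
  qed
  moreover have "cmod (z0 ^ k) \<le> 1" using z0 by (simp add: norm_power power_le_one)
  ultimately obtain a' b' d' where *: "bounded_matrix 1 a' b' (z0 ^ k * ?c z0) d'" "a' + d' = ?s z0 / 2 + ?s z0 / 2"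
    "a' * d' - b' * (z0 ^ k * ?c z0) = ?p z0"
    using shrink_corner[OF B] by metis
  have "vector [poly N1 z0 / poly D z0, ?s z0, ?p z0]
      = (vector [z0 ^ k * ?c z0, a' + d', a' * d' - b' * (z0 ^ k * ?c z0)] :: complex^3)"
    unfolding *(2,3) by (simp add: N1)
  then show ?thesis using *(1) unfolding closure_pentablock_iff by blast
qed

lemma rational_P_inner_quotient:
  assumes G: "Gamma_inner_quotient n N2 D" and I: "modulus_identity N1 N2 D"
  shows "rational_P_inner (\<lambda>z. vector [poly N1 z / poly D z, poly N2 z / poly D z,
    poly (conj_reverse n D) z / poly D z])"
  unfolding rational_P_inner_def distinguished_boundary_pentablock
proof (intro conjI ballI allI)
  note Q = Gamma_inner_quotientD[OF G]
  let ?x = "\<lambda>z. vector [poly N1 z / poly D z, poly N2 z / poly D z, poly (conj_reverse n D) z / poly D z] :: complex^3"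
  show "(\<lambda>z. ?x z $ i) holomorphic_on ball 0 1" for i
    using exhaust_3[of i] Q(2) by (auto intro!: holomorphic_intros)
  show "rational_cdisc (\<lambda>z. ?x z $ i)" for i
    using exhaust_3[of i] Q(2) by (auto intro!: rational_cdisc_quotient)
  show "?x ` ball 0 1 \<subseteq> closure pentablock"
    using quotient_in_closure_pentablock[OF G I] by auto
  show "?x z \<in> penta_boundary" if "z \<in> sphere 0 1" for z
    using that Q(2) by (intro penta_boundary_quotientI Q(5) modulus_identity_quotient[OF I]) auto
qed

section \<open>Existence of the factorization\<close>

lemma dvd_antisym_smult:
  fixes p q :: "complex poly"
  assumes "p dvd q" "q dvd p" "p \<noteq> 0"
  obtains c where "c \<noteq> 0" "p = smult c q"
proof -
  obtain r where r: "p = q * r" using assms(2) by blast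
  then have nz: "q \<noteq> 0" "r \<noteq> 0" using assms(3) by auto
  have "degree p \<le> degree q" using assms(1) nz by (intro dvd_imp_degree_le) auto
  then have "degree r = 0" using r nz by (simp add: degree_mult_eq)
  then obtain c where "r = [:c:]" by (rule degree_eq_zeroE)
  then show thesis using that[of c] r nz by simp
qed

text \<open>Equal moduli on the circle give \<open>u * u~ = v * v~\<close>, with \<open>~\<close>
  for reversal at order \<open>n\<close>. Coprimality then gives \<open>v~ = u * w\<close> and
  \<open>u~ = v * w\<close>, and since \<open>u\<close> or \<open>v\<close> has degree
  \<open>n\<close>, the common cofactor \<open>w\<close> is a constant \<open>k\<close>, necessarily
  unimodular.\<close>

lemma unimodular_quotient_form:
  assumes uv: "coprime u v" and nz: "\<And>z. cmod z \<le> 1 \<Longrightarrow> poly v z \<noteq> 0"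
    and uni: "\<And>z. cmod z = 1 \<Longrightarrow> cmod (poly u z) = cmod (poly v z)"
    and n: "n = max (degree u) (degree v)"
  obtains e where "e \<noteq> 0" "conj_reverse n (smult e v) = smult e u"
proof -
  have d: "degree u \<le> n" "degree v \<le> n" by (simp_all add: n)
  have v0: "v \<noteq> 0" using nz[of 0] by auto
  have u1: "poly u 1 \<noteq> 0" using uni[of 1] nz[of 1] by auto
  then have u0: "u \<noteq> 0" by auto
  have eq: "u * conj_reverse n u = v * conj_reverse n v"
    by (rule poly_eqI_circle) (simp only: mult_conj_reverse_circle[OF d(1)] mult_conj_reverse_circle[OF d(2)] uni)
  then have "u dvd v * conj_reverse n v" by (metis dvd_triv_left)
  then obtain w where w: "conj_reverse n v = u * w"
    using uv by (auto simp: coprime_dvd_mult_right_iff)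
  then have w': "conj_reverse n u = v * w" using eq u0 by (simp add: mult_ac)
  have "w \<noteq> 0" using w v0 d(2) by (auto simp: conj_reverse_eq_0_iff)
  then have "degree u + degree w \<le> n" "degree v + degree w \<le> n"
    using degree_conj_reverse_le[of n v] degree_conj_reverse_le[of n u] u0 v0
    by (simp_all add: w w' degree_mult_eq)
  then have "degree w = 0" by (auto simp: n max_def split: if_splits)
  then obtain k where "w = [:k:]" by (rule degree_eq_zeroE)
  then have k: "conj_reverse n v = smult k u" using w by simp
  have "cmod (poly (conj_reverse n v) 1) = cmod (poly u 1)"
    using poly_conj_reverse_circle[OF d(2), of 1] uni[of 1] by simp
  then have "cmod k * cmod (poly u 1) = cmod (poly u 1)" by (simp add: k norm_mult)
  then have k1: "cmod k = 1" using u1 by simp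
  \<comment> \<open>Reversal conjugates scalars, so scaling \<open>v\<close> by \<open>e\<close>
    turns the constant \<open>k\<close> into \<open>cnj e * k\<close>. A unimodular square root of
    \<open>k\<close> makes this equal to \<open>e\<close>, and the constant cancels in the
    quotient.\<close>
  define e where "e = csqrt k"
  have e2: "e * e = k" by (simp add: e_def power2_eq_square[symmetric])
  then have "cmod e * cmod e = 1" using k1 by (metis norm_mult)
  then have e1: "cmod e = 1" by (metis norm_ge_zero power2_eq_1_iff power2_eq_square
        abs_of_nonneg abs_minus_cancel abs_one)
  then have "cnj e * e = 1" using complex_norm_square[of e] by (simp add: mult.commute)
  then have "cnj e * k = e" unfolding e2[symmetric] mult.assoc[symmetric] by simp
  then have "conj_reverse n (smult e v) = smult e u" by (simp add: conj_reverse_smult k)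
  moreover have "e \<noteq> 0" using e1 by auto
  ultimately show thesis using that by blast
qed

lemma quotient_sphere_eq:
  fixes a b c d :: real
  assumes "(a / b)\<^sup>2 = 1 - (c / d)\<^sup>2 / 4" "b \<noteq> 0" "d \<noteq> 0"
  shows "a\<^sup>2 * d\<^sup>2 = b\<^sup>2 * (d\<^sup>2 - 1/4 * c\<^sup>2)"
proof -
  define C where "C = (c / d)\<^sup>2"
  have a: "a\<^sup>2 = (1 - C / 4) * b\<^sup>2"
    using assms(2) unfolding C_def assms(1)[symmetric] by (simp add: power_divide)
  have c: "c\<^sup>2 = C * d\<^sup>2" using assms(3) by (simp add: C_def power_divide)
  show ?thesis unfolding a c by (simp add: algebra_simps)
qed

lemma P_inner_factorization_exists:
  assumes x: "rational_P_inner x" and n: "rat_degree (\<lambda>z. x z $ 3) = n"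
  shows "\<exists>N1 N2 D B. finite_Blaschke B \<and> P_inner_factorization x n B N1 N2 D"
proof -
  have "rational_cdisc (\<lambda>z. x z $ 3)" "rational_cdisc (\<lambda>z. x z $ 2)" "rational_cdisc (\<lambda>z. x z $ 1)"
    and cl: "\<And>z. cmod z < 1 \<Longrightarrow> x z \<in> closure pentablock"
    and bd: "\<And>z. cmod z = 1 \<Longrightarrow> x z \<in> penta_boundary"
    using x unfolding rational_P_inner_def distinguished_boundary_pentablock by auto
  then obtain u v f2 g2 f1 g1 where lt: "lowest_terms (\<lambda>z. x z $ 3) u v"
    "lowest_terms (\<lambda>z. x z $ 2) f2 g2" "lowest_terms (\<lambda>z. x z $ 1) f1 g1"
    unfolding rational_cdisc_def by blast
  have cop: "coprime u v" "coprime f2 g2" "coprime f1 g1"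
    and nzv: "\<And>z. cmod z \<le> 1 \<Longrightarrow> poly v z \<noteq> 0"
    and nz2: "\<And>z. cmod z \<le> 1 \<Longrightarrow> poly g2 z \<noteq> 0"
    and nz1: "\<And>z. cmod z \<le> 1 \<Longrightarrow> poly g1 z \<noteq> 0"
    and x3: "\<And>z. cmod z \<le> 1 \<Longrightarrow> x z $ 3 = poly u z / poly v z"
    and x2: "\<And>z. cmod z \<le> 1 \<Longrightarrow> x z $ 2 = poly f2 z / poly g2 z"
    and x1: "\<And>z. cmod z \<le> 1 \<Longrightarrow> x z $ 1 = poly f1 z / poly g1 z"
    using lt unfolding lowest_terms_def by auto
  have n': "n = max (degree u) (degree v)" using rat_degree_eq[OF lt(1)] n by simp
  have "cmod (poly u z) = cmod (poly v z)" if "cmod z = 1" for z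
    using penta_boundaryD(3)[OF bd[OF that]] x3[of z] nzv[of z] that by (simp add: norm_divide)
  then obtain e where e: "e \<noteq> 0" "conj_reverse n (smult e v) = smult e u"
    using unimodular_quotient_form[OF cop(1) nzv _ n'] by blast
  define D where "D = smult e v"
  have dD: "degree D \<le> n" using e(1) by (simp add: D_def n')
  have nzD: "poly D z \<noteq> 0" if "cmod z \<le> 1" for z using nzv[OF that] e(1) by (simp add: D_def)
  have x3D: "x z $ 3 = poly (conj_reverse n D) z / poly D z" if "cmod z \<le> 1" for z
    using x3[OF that] e by (simp add: D_def)
  have "g2 dvd D"
  proof -
    \<comment> \<open>Reversing \<open>f2\<close> and \<open>g2\<close> at a common order puts the
      same power of \<open>z\<close> on both sides. The denominator \<open>g2\<close> then divides a
      product in which both \<open>f2\<close> and the reversal of \<open>g2\<close> are coprime to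
      it, so it divides \<open>D\<close>.\<close>
    define m where "m = max (degree f2) (degree g2)"
    have "f2 * (conj_reverse m g2 * D) = g2 * (conj_reverse m f2 * conj_reverse n D)"
    proof (rule poly_eqI_circle)
      fix z :: complex assume z: "cmod z = 1"
      then have z1: "cmod z \<le> 1" by simp
      have "poly f2 z / poly g2 z = cnj (poly f2 z / poly g2 z) * (poly (conj_reverse n D) z / poly D z)"
        using penta_boundaryD(2)[OF bd[OF z]] unfolding x2[OF z1] x3D[OF z1] .
      then have "poly f2 z * (cnj (poly g2 z) * poly D z) = poly g2 z * (cnj (poly f2 z) * poly (conj_reverse n D) z)"
        using nz2[of z] nzD[of z] z by (simp add: field_simps)
      then show "poly (f2 * (conj_reverse m g2 * D)) z = poly (g2 * (conj_reverse m f2 * conj_reverse n D)) z"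
        using poly_conj_reverse_circle[of f2 m z] poly_conj_reverse_circle[of g2 m z] z
        by (simp add: m_def mult_ac)
    qed
    then have "g2 dvd f2 * (conj_reverse m g2 * D)" by (metis dvd_triv_left)
    moreover have "coprime g2 (conj_reverse m g2)"
      using nz2 by (intro coprime_conj_reverse) (auto simp: m_def)
    ultimately show ?thesis
      using cop(2) by (simp add: coprime_dvd_mult_right_iff coprime_commute)
  qed
  then obtain h where h: "D = g2 * h" by blast
  define N2 where "N2 = f2 * h"
  have x2D: "x z $ 2 = poly N2 z / poly D z" if "cmod z \<le> 1" for z
    using x2[OF that] nzD[OF that] by (simp add: N2_def h)
  have G: "Gamma_inner_quotient n N2 D"
    unfolding Gamma_inner_quotient_def rational_Gamma_inner_def distinguished_boundary_sym_bidisc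
  proof (intro conjI ballI allI)
    let ?h = "\<lambda>z. vector [poly N2 z / poly D z, poly (conj_reverse n D) z / poly D z] :: complex^2"
    have hx: "?h z = vector [x z $ 2, x z $ 3]" if "cmod z \<le> 1" for z
      using x2D[OF that] x3D[OF that] by simp
    show "(\<lambda>z. ?h z $ i) holomorphic_on ball 0 1" for i
      using exhaust_2[of i] nzD by (auto intro!: holomorphic_intros)
    show "rational_cdisc (\<lambda>z. ?h z $ i)" for i
      using exhaust_2[of i] nzD by (auto intro!: rational_cdisc_quotient)
    show "?h ` ball 0 1 \<subseteq> closure sym_bidisc"
      using closure_pentablock_project[OF cl] hx by auto
    show "?h z \<in> Gamma_boundary" if "z \<in> sphere 0 1" for z
    proof -
      have z: "cmod z = 1" using that by simp
      show ?thesis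
        by (subst hx, use z in simp, rule Gamma_boundaryI, unfold vector_2) (rule penta_boundaryD[OF bd[OF z]])+
    qed
  qed (use dD nzD in auto)
  note Q = Gamma_inner_quotientD[OF G]
  have mod: "(cmod (poly f1 z))\<^sup>2 * (cmod (poly D z))\<^sup>2
      = (cmod (poly g1 z))\<^sup>2 * ((cmod (poly D z))\<^sup>2 - 1/4 * (cmod (poly N2 z))\<^sup>2)" if z: "cmod z = 1" for z
  proof -
    have z1: "cmod z \<le> 1" using z by simp
    have "(cmod (poly f1 z / poly g1 z))\<^sup>2 = 1 - (cmod (poly N2 z / poly D z))\<^sup>2 / 4"
      using penta_boundaryD(4)[OF bd[OF z]] unfolding x1[OF z1] x2D[OF z1] .
    then show ?thesis
      using nz1[OF z1] nzD[OF z1] unfolding norm_divide by (intro quotient_sphere_eq) simp_all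
  qed
  obtain B N1 where B: "finite_Blaschke B" and dN: "degree N1 \<le> n" and I: "modulus_identity N1 N2 D"
    and x1D: "\<And>z. cmod z \<le> 1 \<Longrightarrow> x z $ 1 = B z * (poly N1 z / poly D z)"
  proof (cases "f1 = 0")
    case True
    \<comment> \<open>A vanishing first coordinate has no outer factor, but the gap then vanishes on
      the circle and \<open>N1 = 0\<close> with \<open>B = 1\<close> will do.\<close>
    have "(cmod (poly D z))\<^sup>2 - 1/4 * (cmod (poly N2 z))\<^sup>2 = 0" if "cmod z = 1" for z
      using mod[OF that] nz1[of z] that True by simp
    then have "modulus_identity 0 N2 D" by (simp add: modulus_identity_def)
    then show thesis using that[OF finite_Blaschke_one, of 0] x1 True by simp
  next
    case False
    then obtain B F where BF: "finite_Blaschke B" "\<And>z. cmod z < 1 \<Longrightarrow> poly F z \<noteq> 0"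
      "\<And>z. cmod z \<le> 1 \<Longrightarrow> poly f1 z = B z * poly F z"
      "\<And>z. cmod z = 1 \<Longrightarrow> cmod (poly f1 z) = cmod (poly F z)"
      by (rule Blaschke_outer_factorization) blast
    define m where "m = max (degree F) (degree g1)"
    have m: "degree F \<le> m" "degree g1 \<le> m" by (simp_all add: m_def)
    have "(F * conj_reverse m F) * (D * conj_reverse n D) = (g1 * conj_reverse m g1) * boundary_gap n N2 D"
    proof (rule poly_eqI_circle)
      fix z :: complex assume z: "cmod z = 1"
      have "complex_of_real ((cmod (poly F z))\<^sup>2) * of_real ((cmod (poly D z))\<^sup>2)
        = of_real ((cmod (poly g1 z))\<^sup>2) * of_real ((cmod (poly D z))\<^sup>2 - 1/4 * (cmod (poly N2 z))\<^sup>2)"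
        unfolding of_real_mult[symmetric] using mod[OF z] BF(4)[OF z] by (simp only:)
      then show "poly ((F * conj_reverse m F) * (D * conj_reverse n D)) z
          = poly ((g1 * conj_reverse m g1) * boundary_gap n N2 D) z"
        unfolding poly_mult[of "F * conj_reverse m F"] poly_mult[of "g1 * conj_reverse m g1"]
          mult_conj_reverse_circle[OF m(1) z] mult_conj_reverse_circle[OF m(2) z]
          mult_conj_reverse_circle[OF dD z] boundary_gap_circle[OF dD Q(3) z]
        by (simp only: mult_ac)
    qed
    then have "g1 dvd (F * D) * (conj_reverse m F * conj_reverse n D)"
      by (metis dvd_triv_left mult.assoc mult.left_commute)
    \<comment> \<open>Here it matters that \<open>F\<close> has no zeros in the open disc; for
      \<open>f1\<close> itself the coprimality could fail.\<close>
    moreover have "coprime g1 (conj_reverse m F * conj_reverse n D)"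
      using nz1 BF(2) nzD m(1) dD by (intro coprime_mult_right_iff[THEN iffD2] conjI coprime_conj_reverse) auto
    ultimately have "g1 dvd F * D" by (simp add: coprime_dvd_mult_left_iff)
    then obtain N1 where N1: "F * D = g1 * N1" by blast
    then have N1z: "poly F z * poly D z = poly g1 z * poly N1 z" for z by (metis poly_mult)
    have I: "modulus_identity N1 N2 D"
      unfolding modulus_identity_def
    proof
      fix z :: complex assume "z \<in> sphere 0 1"
      then have z: "cmod z = 1" by simp
      have "(cmod (poly g1 z))\<^sup>2 * (cmod (poly N1 z))\<^sup>2 = (cmod (poly f1 z))\<^sup>2 * (cmod (poly D z))\<^sup>2"
        unfolding BF(4)[OF z] power_mult_distrib[symmetric] norm_mult[symmetric] N1z ..
      then show "(cmod (poly N1 z))\<^sup>2 = (cmod (poly D z))\<^sup>2 - 1/4 * (cmod (poly N2 z))\<^sup>2"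
        using mod[OF z] nz1[of z] z by simp
    qed
    \<comment> \<open>The value at the origin is inherited from \<open>F\<close> and
      \<open>D\<close>; it is what makes the degree bound on \<open>N1\<close> available.\<close>
    have "poly N1 0 \<noteq> 0" using N1z[of 0] BF(2)[of 0] nzD[of 0] by auto
    then have "degree N1 \<le> n"
    proof (rule degree_le_trig_degree[OF _ degree_boundary_gap[OF dD Q(3)]])
      show "poly (boundary_gap n N2 D) z = z ^ n * of_real ((cmod (poly N1 z))\<^sup>2)" if "cmod z = 1" for z
        using I that unfolding boundary_gap_circle[OF dD Q(3) that] modulus_identity_def by simp
    qed
    moreover have "x z $ 1 = B z * (poly N1 z / poly D z)" if "cmod z \<le> 1" for z
    proof -
      have "poly F z = poly g1 z * poly N1 z / poly D z"
        using N1z[of z] nzD[OF that] by (simp add: eq_divide_eq)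
      then show ?thesis unfolding x1[OF that] BF(3)[OF that] using nz1[OF that] by simp
    qed
    ultimately show thesis using that[OF BF(1) _ I] by blast
  qed
  then have "P_inner_factorization x n B N1 N2 D"
    unfolding P_inner_factorization_def using G x2D x3D by simp
  with B show ?thesis by blast
qed

section \<open>Uniqueness up to a real factor\<close>

lemma finite_Blaschke_nonzero_circle:
  assumes "finite_Blaschke B" "cmod z = 1"
  shows "B z \<noteq> 0"
proof -
  obtain \<theta> k a where a: "\<forall>j\<in>{1..k::nat}. a j \<in> ball 0 1"
    and B: "B = (\<lambda>z. exp (\<i> * of_real \<theta>) * (\<Prod>j=1..k. (z - a j) / (1 - cnj (a j) * z)))"
    using assms(1) unfolding finite_Blaschke_def by blast
  have "(z - a j) / (1 - cnj (a j) * z) \<noteq> 0" if "j \<in> {1..k}" for j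
  proof -
    have "cmod (a j) < 1" using a that by auto
    then show ?thesis using cmod_Moebius_denominator[of "a j" z] assms(2) by auto
  qed
  then show ?thesis by (simp add: B)
qed

text \<open>Being real, \<open>t\<close> survives the conjugation in the reversal unchanged and
  cancels in the third coordinate as well.\<close>

lemma P_inner_factorization_scale:
  fixes t :: real
  assumes P: "P_inner_factorization x n B N1 N2 D" and t: "t \<noteq> 0"
  shows "P_inner_factorization x n B (smult (of_real t) N1) (smult (of_real t) N2) (smult (of_real t) D)"
proof -
  have "modulus_identity (smult (of_real t) N1) (smult (of_real t) N2) (smult (of_real t) D)"
    using P unfolding P_inner_factorization_def modulus_identity_def
    by (simp add: norm_mult power_mult_distrib right_diff_distrib)
  then show ?thesis
    using P t unfolding P_inner_factorization_def Gamma_inner_quotient_def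
    by (simp add: conj_reverse_smult)
qed

text \<open>The third coordinate is reduced in both representations, so the denominators divide each
  other and differ by a constant \<open>c\<close>; comparing the reversals gives
  \<open>cnj c = c\<close>. The Blaschke product can be cancelled on the circle, where it has no
  zeros, and agreement there determines the polynomials.\<close>

lemma P_inner_factorization_unique:
  assumes B: "finite_Blaschke B"
    and P: "P_inner_factorization x n B N1 N2 D" and P': "P_inner_factorization x n B N1' N2' D'"
  obtains t :: real where "t \<noteq> 0" "N1 = smult (of_real t) N1'" "N2 = smult (of_real t) N2'" "D = smult (of_real t) D'"
proof -
  note Q = Gamma_inner_quotientD[OF P[unfolded P_inner_factorization_def, THEN conjunct1]]
  note Q' = Gamma_inner_quotientD[OF P'[unfolded P_inner_factorization_def, THEN conjunct1]]
  have eq: "poly N2 z * poly D' z = poly N2' z * poly D z"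
    "poly (conj_reverse n D) z * poly D' z = poly (conj_reverse n D') z * poly D z"
    "poly N1 z * poly D' z = poly N1' z * poly D z" if z: "cmod z = 1" for z
  proof -
    have "poly N2 z / poly D z = poly N2' z / poly D' z"
      "poly (conj_reverse n D) z / poly D z = poly (conj_reverse n D') z / poly D' z"
      "B z * (poly N1 z / poly D z) = B z * (poly N1' z / poly D' z)"
      using P P' z unfolding P_inner_factorization_def by simp_all
    then show "poly N2 z * poly D' z = poly N2' z * poly D z"
      "poly (conj_reverse n D) z * poly D' z = poly (conj_reverse n D') z * poly D z"
      "poly N1 z * poly D' z = poly N1' z * poly D z"
      using finite_Blaschke_nonzero_circle[OF B z] Q(2)[of z] Q'(2)[of z] z by (simp_all add: frac_eq_eq)
  qed
  have D0: "D \<noteq> 0" "D' \<noteq> 0" using Q(2)[of 0] Q'(2)[of 0] by auto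
  have peq: "N2 * D' = N2' * D" "conj_reverse n D * D' = conj_reverse n D' * D" "N1 * D' = N1' * D"
    by (rule poly_eqI_circle; simp only: poly_mult eq)+
  have "coprime D (conj_reverse n D)" "coprime D' (conj_reverse n D')"
    using Q(1,2) Q'(1,2) by (intro coprime_conj_reverse; auto)+
  moreover have "D dvd conj_reverse n D * D'" "D' dvd conj_reverse n D' * D"
    using peq(2) by (metis dvd_triv_right)+
  ultimately have "D dvd D'" "D' dvd D" by (simp_all add: coprime_dvd_mult_right_iff)
  then obtain c where c: "c \<noteq> 0" "D = smult c D'" using dvd_antisym_smult D0(1) by blast
  have "smult (cnj c) (conj_reverse n D' * D') = smult c (conj_reverse n D' * D')"
    using peq(2) unfolding c(2) conj_reverse_smult by simp
  moreover have "conj_reverse n D' * D' \<noteq> 0" using D0(2) Q'(1) by (simp add: conj_reverse_eq_0_iff)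
  ultimately have "cnj c = c"
    by (metis smult_diff_left smult_eq_0_iff right_minus_eq)
  then have cr: "c = of_real (Re c)" by (simp add: complex_eq_iff)
  have "N2 * D' = smult c N2' * D'" "N1 * D' = smult c N1' * D'"
    using peq(1,3) unfolding c(2) by simp_all
  then have "N2 = smult c N2'" "N1 = smult c N1'" using D0(2) by (simp_all only: mult_right_cancel simp_thms)
  then show thesis using that[of "Re c"] c cr by (metis of_real_0)
qed

theorem theorem3p9:
  shows
    "(\<forall>x n. rational_P_inner x \<and> rat_degree (\<lambda>z. x z $ 3) = n \<longrightarrow>
        (\<exists>N1 N2 D B. finite_Blaschke B \<and> P_inner_factorization x n B N1 N2 D))
   \<and> (\<forall>n N1 N2 D. Gamma_inner_quotient n N2 D \<and> modulus_identity N1 N2 D \<longrightarrow>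
        rational_P_inner (\<lambda>z. vector [poly N1 z / poly D z, poly N2 z / poly D z,
                                      poly (conj_reverse n D) z / poly D z])
        \<and> rat_degree (\<lambda>z. poly (conj_reverse n D) z / poly D z) = n)
   \<and> (\<forall>x n B N1 N2 D.
        rational_P_inner x \<and> rat_degree (\<lambda>z. x z $ 3) = n \<and> finite_Blaschke B \<and>
        P_inner_factorization x n B N1 N2 D \<longrightarrow>
        (\<forall>N1' N2' D'. P_inner_factorization x n B N1' N2' D' \<longleftrightarrow>
           (\<exists>t::real. t \<noteq> 0 \<and> N1 = smult (of_real t) N1' \<and>
              N2 = smult (of_real t) N2' \<and> D = smult (of_real t) D')))"
proof (intro conjI allI impI)
  show "\<exists>N1 N2 D B. finite_Blaschke B \<and> P_inner_factorization x n B N1 N2 D"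
    if "rational_P_inner x \<and> rat_degree (\<lambda>z. x z $ 3) = n" for x n
    using that P_inner_factorization_exists by blast
next
  fix n N1 N2 D
  assume GI: "Gamma_inner_quotient n N2 D \<and> modulus_identity N1 N2 D"
  then show "rational_P_inner (\<lambda>z. vector [poly N1 z / poly D z, poly N2 z / poly D z,
      poly (conj_reverse n D) z / poly D z])"
    using rational_P_inner_quotient by blast
  show "rat_degree (\<lambda>z. poly (conj_reverse n D) z / poly D z) = n"
    using GI Gamma_inner_quotientD(1,2) by (intro rat_degree_conj_reverse_quotient) blast+
next
  fix x n B N1 N2 D N1' N2' D'
  assume *: "rational_P_inner x \<and> rat_degree (\<lambda>z. x z $ 3) = n \<and> finite_Blaschke B \<and>
    P_inner_factorization x n B N1 N2 D"
  show "P_inner_factorization x n B N1' N2' D' \<longleftrightarrow>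
    (\<exists>t::real. t \<noteq> 0 \<and> N1 = smult (of_real t) N1' \<and> N2 = smult (of_real t) N2' \<and> D = smult (of_real t) D')"
  proof
    assume "P_inner_factorization x n B N1' N2' D'"
    then show "\<exists>t::real. t \<noteq> 0 \<and> N1 = smult (of_real t) N1' \<and> N2 = smult (of_real t) N2' \<and> D = smult (of_real t) D'"
      using * P_inner_factorization_unique[of B x n N1 N2 D N1' N2' D'] by blast
  next
    assume "\<exists>t::real. t \<noteq> 0 \<and> N1 = smult (of_real t) N1' \<and> N2 = smult (of_real t) N2' \<and> D = smult (of_real t) D'"
    then obtain t :: real where t: "t \<noteq> 0" "N1 = smult (of_real t) N1'" "N2 = smult (of_real t) N2'"
      "D = smult (of_real t) D'" by blast
    \<comment> \<open>The given equations express the unprimed triple through the primed one, so the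
      scaling is applied with \<open>inverse t\<close>.\<close>
    have "smult (of_real (inverse t)) (smult (of_real t) p) = p" for p :: "complex poly"
      using t(1) by (simp flip: of_real_mult)
    then show "P_inner_factorization x n B N1' N2' D'"
      using P_inner_factorization_scale[of x n B N1 N2 D "inverse t"] * t(1) unfolding t(2-4) by simp
  qed
qed

end
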